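(* Let $\lambda\in\mathbb{C}^*$, $a,b,\dot c,h,a_1,b_1\in\mathbb{C}$, and let $W\in\mathcal{O}_{\mathfrak{W}}$ be a nontrivial simple $\mathfrak{W}$-module. Then the simple modules among $\mathcal{L}(W,\lambda,a,b)$ (when it is simple), $\mathcal{L}_0(a,b)$ and $\mathcal{L}_1(a,b)$ (when $b\ne0$, so that they are defined) are not isomorphic to any simple submodule of the $\mathfrak{V}$-module $V(\dot c,h)\otimes A'_{a_1,b_1}$.
   Context: $\mathbb{Z}_+$ denotes the nonnegative integers. The Virasoro algebra $\mathfrak{V}$ has basis $\{d_n,z : n\in\mathbb{Z}\}$, $z$ central, $[d_n,d_m]=(m-n)d_{m+n}+\delta_{n,-m}\frac{n^3-n}{12}z$. $\mathfrak{W}=\mathrm{Der}(\mathbb{C}[t])$ has basis $\{d_i=t^{i+1}\frac{d}{dt} : i\ge-1\}$ with $[d_n,d_m]=(m-n)d_{m+n}$. $\mathcal{O}_{\mathfrak{W}}$ is the category of all $\mathfrak{W}$-modules $W$ such that for every $w\in W$ there is a nonnegative integer $n$ (depending on $w$) with $d_iw=0$ for all $i\ge n$. A module $V$ over a Lie algebra $L$ is trivial if $LV=0$, nontrivial otherwise. For $W\in\mathcal{O}_{\mathfrak{W}}$, $\lambda\in\mathbb{C}^*$, $a,b\in\mathbb{C}$, $\mathcal{L}(W,\lambda,a,b)=W\otimes\mathbb{C}[t,t^{-1}]$ is the $\mathfrak{V}$-module with $z\cdot(w\otimes t^j)=0$ and $d_k\cdot(w\otimes t^j)=\big(((\lambda^ke^{kt}-1)\frac{d}{dt}+a+kb+j)w\big)\otimes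 t^{k+j}$ for $k,j\in\mathbb{Z}$, $w\in W$, where $\frac{d}{dt}$ acts as $d_{-1}$ and $e^{kt}\frac{d}{dt}$ acts as $\sum_{i\ge0}\frac{k^i}{i!}d_{i-1}$. For $a\in\mathbb{C}$ and $b\in\mathbb{C}^*$, let $W'$ be the highest weight $\mathfrak{W}$-module generated by a nonzero vector $w_0'$ with $d_0w_0'=bw_0'$, $d_iw_0'=0$ for $i>0$ (it has basis $\{d_{-1}^kw_0' : k\in\mathbb{Z}_+\}$); then $\mathcal{L}_0(a,b)=\mathrm{span}\{d_1^i\cdot(w_0'\otimes t^{2j}) : i\in\mathbb{Z}_+,j\in\mathbb{Z}\}$ and $\mathcal{L}_1(a,b)=\mathrm{span}\{d_1^i\cdot(w_0'\otimes t^{2j+1}) : i\in\mathbb{Z}_+,j\in\mathbb{Z}\}$, which are $\mathfrak{V}$-submodules of $\mathcal{L}(W',-1,a,b+1)$. For $\dot c,h\in\mathbb{C}$, let $I(\dot c,h)$ be the left ideal of $U(\mathfrak{V})$ generated by $\{d_i : i>0\}\cup\{d_0-h\cdot1,\ z-\dot c\cdot1\}$, let $\bar V(\dot c,h)=U(\mathfrak{V})/I(\dot c,h)$ be the Verma module, and let $V(\dot c,h)=\bar V(\dot c,h)/J$ be the simple highest weight module, where $J$ is the maximal proper submodule of $\bar V(\dot c,h)$. $A_{a,b}$ is the $\mathfrak{V}$-module with basis $\{v_n : n\in\mathbb{Z}\}$, $z$ acting as $0$ and $d_mv_n=(a+n+bm)v_{n+m}$. $A'_{a,b}$ denotes the unique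 nontrivial simple subquotient of $A_{a,b}$: it equals $A_{a,b}$ if that is simple; if $a\in\mathbb{Z}$ and $b=0$ it is $A_{a,0}/\mathbb{C}v_{-a}$; if $a\in\mathbb{Z}$ and $b=1$ it is the submodule $\bigoplus_{n\ne-a}\mathbb{C}v_n$ of $A_{a,1}$. *)

theory Defs
  imports
    Complex_Main
    "HOL.Hull"
    "HOL-Library.Poly_Mapping"
    "HOL-Algebra.Module"
    "HOL-Algebra.QuotRing"
    "HOL-Algebra.Algebraic_Closure_Type"
begin

abbreviation complex_ring :: "complex ring" where
  "complex_ring \<equiv> ring_of_type_algebra"

text \<open>A complex Lie algebra is given by a basis together with the brackets of the basis
  elements, expanded in that basis.\<close>

record 'g lie_alg =
  basis :: "'g set"
  bracket :: "'g \<Rightarrow> 'g \<Rightarrow> 'g \<Rightarrow>\<^sub>0 complex"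

text \<open>A representation is a complex vector space together with one operator for every basis
  element of the Lie algebra. The fields \<open>mult\<close> and \<open>one\<close>, inherited from the record of
  modules, are irrelevant.\<close>

record ('g, 'v) rep = "(complex, 'v) module" +
  act :: "'g \<Rightarrow> 'v \<Rightarrow> 'v"

definition lie_module :: "'g lie_alg \<Rightarrow> ('g, 'v) rep \<Rightarrow> bool" where
  "lie_module L M \<longleftrightarrow>
     module complex_ring M \<and>
     (\<forall>g\<in>basis L. \<forall>v\<in>carrier M. act M g v \<in> carrier M) \<and>
     (\<forall>g\<in>basis L. \<forall>v\<in>carrier M. \<forall>w\<in>carrier M.
        act M g (v \<oplus>\<^bsub>M\<^esub> w) = act M g v \<oplus>\<^bsub>M\<^esub> act M g w) \<and>
     (\<forall>g\<in>basis L. \<forall>c. \<forall>v\<in>carrier M. act M g (c \<odot>\<^bsub>M\<^esub> v) = c \<odot>\<^bsub>M\<^esub> act M g v) \<and>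
     (\<forall>g\<in>basis L. \<forall>g'\<in>basis L. \<forall>v\<in>carrier M.
        act M g (act M g' v) \<ominus>\<^bsub>M\<^esub> act M g' (act M g v) =
        finsum M (\<lambda>k. Poly_Mapping.lookup (bracket L g g') k \<odot>\<^bsub>M\<^esub> act M k v)
          (Poly_Mapping.keys (bracket L g g')))"

definition lie_submodule :: "'g lie_alg \<Rightarrow> ('g, 'v) rep \<Rightarrow> 'v set \<Rightarrow> bool" where
  "lie_submodule L M S \<longleftrightarrow>
     submodule S complex_ring M \<and> (\<forall>g\<in>basis L. \<forall>v\<in>S. act M g v \<in> S)"

definition simple_module :: "'g lie_alg \<Rightarrow> ('g, 'v) rep \<Rightarrow> bool" where
  "simple_module L M \<longleftrightarrow>
     lie_module L M \<and> carrier M \<noteq> {\<zero>\<^bsub>M\<^esub>} \<and>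
     (\<forall>S. lie_submodule L M S \<longrightarrow> S = {\<zero>\<^bsub>M\<^esub>} \<or> S = carrier M)"

definition nontrivial_module :: "'g lie_alg \<Rightarrow> ('g, 'v) rep \<Rightarrow> bool" where
  "nontrivial_module L M \<longleftrightarrow> (\<exists>g\<in>basis L. \<exists>v\<in>carrier M. act M g v \<noteq> \<zero>\<^bsub>M\<^esub>)"

definition maximal_submodule :: "'g lie_alg \<Rightarrow> ('g, 'v) rep \<Rightarrow> 'v set \<Rightarrow> bool" where
  "maximal_submodule L M J \<longleftrightarrow>
     lie_submodule L M J \<and> J \<noteq> carrier M \<and>
     (\<forall>S. lie_submodule L M S \<and> J \<subseteq> S \<longrightarrow> S = J \<or> S = carrier M)"

definition isomorphic_modules ::
  "'g lie_alg \<Rightarrow> ('g, 'v) rep \<Rightarrow> ('g, 'w) rep \<Rightarrow> bool" where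
  "isomorphic_modules L M N \<longleftrightarrow>
     (\<exists>f \<in> Group.iso (add_monoid M) (add_monoid N).
        (\<forall>c. \<forall>v\<in>carrier M. f (c \<odot>\<^bsub>M\<^esub> v) = c \<odot>\<^bsub>N\<^esub> f v) \<and>
        (\<forall>g\<in>basis L. \<forall>v\<in>carrier M. f (act M g v) = act N g (f v)))"

definition isomorphic_to_simple_submodule ::
  "'g lie_alg \<Rightarrow> ('g, 'v) rep \<Rightarrow> ('g, 'w) rep \<Rightarrow> bool" where
  "isomorphic_to_simple_submodule L M T \<longleftrightarrow>
     (\<exists>N. lie_submodule L T N \<and> simple_module L (T\<lparr>carrier := N\<rparr>) \<and>
        isomorphic_modules L M (T\<lparr>carrier := N\<rparr>))"

definition linear_span :: "('g, 'v) rep \<Rightarrow> 'v set \<Rightarrow> 'v set" where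
  "linear_span M B = (\<lambda>S. submodule S complex_ring M) hull B"

text \<open>The operations on cosets of \<open>N\<close> are well defined if \<open>N\<close> is a submodule of \<open>M\<close>; the
  union then ranges over a family of equal cosets.\<close>

definition quotient_module :: "('g, 'v) rep \<Rightarrow> 'v set \<Rightarrow> ('g, 'v set) rep" where
  "quotient_module M N =
     \<lparr>carrier = a_rcosets\<^bsub>M\<^esub> N, monoid.mult = undefined, one = undefined,
      zero = N, add = set_add M,
      module.smult = (\<lambda>c B. \<Union>x\<in>B. N +>\<^bsub>M\<^esub> (c \<odot>\<^bsub>M\<^esub> x)),
      act = (\<lambda>g B. \<Union>x\<in>B. N +>\<^bsub>M\<^esub> act M g x)\<rparr>"

text \<open>The tensor product is the free vector space on all pairs modulo the bilinearity
  relations, with \<open>g (u \<otimes> v) = g u \<otimes> v + u \<otimes> g v\<close>.\<close>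

definition free_pairs ::
  "('g, 'u) rep \<Rightarrow> ('g, 'v) rep \<Rightarrow> ('g, ('u \<times> 'v) \<Rightarrow>\<^sub>0 complex) rep" where
  "free_pairs M N =
     \<lparr>carrier = {p. Poly_Mapping.keys p \<subseteq> carrier M \<times> carrier N},
      monoid.mult = undefined, one = undefined, zero = 0, add = (+),
      module.smult = (\<lambda>c. Poly_Mapping.map ((*) c)),
      act = (\<lambda>g p. \<Sum>(u, v)\<in>Poly_Mapping.keys p.
               Poly_Mapping.single (act M g u, v) (Poly_Mapping.lookup p (u, v)) +
               Poly_Mapping.single (u, act N g v) (Poly_Mapping.lookup p (u, v)))\<rparr>"

definition bilinear_relations ::
  "('g, 'u) rep \<Rightarrow> ('g, 'v) rep \<Rightarrow> (('u \<times> 'v) \<Rightarrow>\<^sub>0 complex) set" where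
  "bilinear_relations M N =
     {Poly_Mapping.single (u \<oplus>\<^bsub>M\<^esub> u', v) 1 - Poly_Mapping.single (u, v) 1
        - Poly_Mapping.single (u', v) 1
      | u u' v. u \<in> carrier M \<and> u' \<in> carrier M \<and> v \<in> carrier N} \<union>
     {Poly_Mapping.single (u, v \<oplus>\<^bsub>N\<^esub> v') 1 - Poly_Mapping.single (u, v) 1
        - Poly_Mapping.single (u, v') 1
      | u v v'. u \<in> carrier M \<and> v \<in> carrier N \<and> v' \<in> carrier N} \<union>
     {Poly_Mapping.single (c \<odot>\<^bsub>M\<^esub> u, v) 1 - Poly_Mapping.single (u, v) c
      | c u v. u \<in> carrier M \<and> v \<in> carrier N} \<union>
     {Poly_Mapping.single (u, c \<odot>\<^bsub>N\<^esub> v) 1 - Poly_Mapping.single (u, v) c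
      | c u v. u \<in> carrier M \<and> v \<in> carrier N}"

definition tensor_module ::
  "('g, 'u) rep \<Rightarrow> ('g, 'v) rep \<Rightarrow> ('g, (('u \<times> 'v) \<Rightarrow>\<^sub>0 complex) set) rep" where
  "tensor_module M N =
     quotient_module (free_pairs M N) (linear_span (free_pairs M N) (bilinear_relations M N))"

text \<open>The Virasoro algebra; \<open>D n\<close> stands for \<open>d\<^sub>n\<close> and \<open>Z\<close> for the central element \<open>z\<close>.\<close>

datatype vir = D int | Z

fun vir_bracket :: "vir \<Rightarrow> vir \<Rightarrow> vir \<Rightarrow>\<^sub>0 complex" where
  "vir_bracket (D n) (D m) =
     Poly_Mapping.single (D (m + n)) (of_int (m - n)) +
     (if n = - m then Poly_Mapping.single Z (of_int (n ^ 3 - n) / 12) else 0)"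
| "vir_bracket _ _ = 0"

definition virasoro :: "vir lie_alg" where
  "virasoro = \<lparr>basis = UNIV, bracket = vir_bracket\<rparr>"

text \<open>The Lie algebra of derivations of the polynomial ring in \<open>t\<close>; the index \<open>i\<close> stands for
  \<open>d\<^sub>i = t\<^bsup>i+1\<^esup> d/dt\<close>. For \<open>n = m = -1\<close> the bracket vanishes, so it never leaves the basis.\<close>

definition witt :: "int lie_alg" where
  "witt = \<lparr>basis = {-1..},
     bracket = (\<lambda>n m. Poly_Mapping.single (m + n) (of_int (m - n)))\<rparr>"

definition category_O :: "(int, 'w) rep \<Rightarrow> bool" where
  "category_O W \<longleftrightarrow>
     lie_module witt W \<and>
     (\<forall>w\<in>carrier W. \<exists>n::nat. \<forall>i\<ge>int n. act W i w = \<zero>\<^bsub>W\<^esub>)"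

text \<open>The action of \<open>e\<^bsup>kt\<^esup> d/dt\<close>. The sum is restricted to its nonzero terms, of which there are
  finitely many on objects of the category above.\<close>

definition exp_der :: "(int, 'w) rep \<Rightarrow> int \<Rightarrow> 'w \<Rightarrow> 'w" where
  "exp_der W k w =
     finsum W (\<lambda>i::nat. (of_int k ^ i / fact i) \<odot>\<^bsub>W\<^esub> act W (int i - 1) w)
       {i. act W (int i - 1) w \<noteq> \<zero>\<^bsub>W\<^esub>}"

text \<open>The tensor product of \<open>W\<close> with the Laurent polynomials is realised by the finitely
  supported functions from the integers to \<open>W\<close>: \<open>f\<close> stands for the sum of all \<open>f j \<otimes> t\<^sup>j\<close>.\<close>

definition laurent_term :: "(int, 'w) rep \<Rightarrow> 'w \<Rightarrow> int \<Rightarrow> int \<Rightarrow> 'w" where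
  "laurent_term W w j = (\<lambda>i. if i = j then w else \<zero>\<^bsub>W\<^esub>)"

definition loop_coeff ::
  "(int, 'w) rep \<Rightarrow> complex \<Rightarrow> complex \<Rightarrow> complex \<Rightarrow> int \<Rightarrow> int \<Rightarrow> 'w \<Rightarrow> 'w" where
  "loop_coeff W lam a b k j w =
     (((lam powi k) \<odot>\<^bsub>W\<^esub> exp_der W k w) \<ominus>\<^bsub>W\<^esub> act W (-1) w) \<oplus>\<^bsub>W\<^esub>
     ((a + of_int k * b + of_int j) \<odot>\<^bsub>W\<^esub> w)"

definition loop_module ::
  "(int, 'w) rep \<Rightarrow> complex \<Rightarrow> complex \<Rightarrow> complex \<Rightarrow> (vir, int \<Rightarrow> 'w) rep" where
  "loop_module W lam a b =
     \<lparr>carrier = {f. (\<forall>j. f j \<in> carrier W) \<and> finite {j. f j \<noteq> \<zero>\<^bsub>W\<^esub>}},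
      monoid.mult = undefined, one = undefined,
      zero = (\<lambda>j. \<zero>\<^bsub>W\<^esub>), add = (\<lambda>f g j. f j \<oplus>\<^bsub>W\<^esub> g j),
      module.smult = (\<lambda>c f j. c \<odot>\<^bsub>W\<^esub> f j),
      act = (\<lambda>x f. case x of
               D k \<Rightarrow> (\<lambda>i. loop_coeff W lam a b k (i - k) (f (i - k)))
             | Z \<Rightarrow> (\<lambda>i. \<zero>\<^bsub>W\<^esub>))\<rparr>"

definition highest_weight_generated :: "(int, 'w) rep \<Rightarrow> 'w \<Rightarrow> complex \<Rightarrow> bool" where
  "highest_weight_generated W w b \<longleftrightarrow>
     lie_module witt W \<and> w \<in> carrier W \<and> w \<noteq> \<zero>\<^bsub>W\<^esub> \<and>
     act W 0 w = b \<odot>\<^bsub>W\<^esub> w \<and> (\<forall>i>0. act W i w = \<zero>\<^bsub>W\<^esub>) \<and>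
     lie_submodule witt W hull {w} = carrier W"

definition loop_part ::
  "int \<Rightarrow> (int, 'w) rep \<Rightarrow> 'w \<Rightarrow> complex \<Rightarrow> complex \<Rightarrow> (vir, int \<Rightarrow> 'w) rep" where
  "loop_part e W w a b =
     (let M = loop_module W (-1) a (b + 1)
      in M\<lparr>carrier :=
           linear_span M {(act M (D 1) ^^ i) (laurent_term W w (2 * j + e)) | (i::nat) (j::int). True}\<rparr>)"

definition loop_module_0 ::
  "(int, 'w) rep \<Rightarrow> 'w \<Rightarrow> complex \<Rightarrow> complex \<Rightarrow> (vir, int \<Rightarrow> 'w) rep" where
  "loop_module_0 = loop_part 0"

definition loop_module_1 ::
  "(int, 'w) rep \<Rightarrow> 'w \<Rightarrow> complex \<Rightarrow> complex \<Rightarrow> (vir, int \<Rightarrow> 'w) rep" where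
  "loop_module_1 = loop_part 1"

text \<open>The enveloping algebra is the free associative algebra on the basis modulo the two-sided
  ideal of the commutator relations. Words are wrapped so that concatenation can serve as the
  addition required by the convolution product of \<^typ>\<open>'a \<Rightarrow>\<^sub>0 'b\<close>.\<close>

datatype 'g word = Word (letters: "'g list")

instantiation word :: (type) monoid_add
begin

definition zero_word :: "'a word" where
  "zero_word = Word []"

definition plus_word :: "'a word \<Rightarrow> 'a word \<Rightarrow> 'a word" where
  "plus_word u v = Word (letters u @ letters v)"

instance
  by standard (auto simp: zero_word_def plus_word_def)

end

type_synonym 'g free_algebra = "'g word \<Rightarrow>\<^sub>0 complex"

abbreviation (input) free_ring :: "vir free_algebra ring" where
  "free_ring \<equiv> ring_of_type_algebra"

definition gen :: "'g \<Rightarrow> 'g free_algebra" where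
  "gen g = Poly_Mapping.single (Word [g]) 1"

definition scalar :: "complex \<Rightarrow> 'g free_algebra" where
  "scalar c = Poly_Mapping.single 0 c"

definition commutator_ideal :: "vir free_algebra set" where
  "commutator_ideal = Idl\<^bsub>free_ring\<^esub>
     {gen x * gen y - gen y * gen x -
        (\<Sum>g\<in>Poly_Mapping.keys (vir_bracket x y).
           scalar (Poly_Mapping.lookup (vir_bracket x y) g) * gen g) | x y. True}"

definition enveloping_ring :: "vir free_algebra set ring" where
  "enveloping_ring = free_ring Quot commutator_ideal"

definition env_class :: "vir free_algebra \<Rightarrow> vir free_algebra set" where
  "env_class p = commutator_ideal +>\<^bsub>free_ring\<^esub> p"

definition enveloping_module :: "(vir, vir free_algebra set) rep" where
  "enveloping_module =
     \<lparr>carrier = carrier enveloping_ring, monoid.mult = monoid.mult enveloping_ring,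
      one = one enveloping_ring, zero = zero enveloping_ring, add = add enveloping_ring,
      module.smult = (\<lambda>c B. env_class (scalar c) \<otimes>\<^bsub>enveloping_ring\<^esub> B),
      act = (\<lambda>g B. env_class (gen g) \<otimes>\<^bsub>enveloping_ring\<^esub> B)\<rparr>"

definition left_ideal :: "('a, 'm) ring_scheme \<Rightarrow> 'a set \<Rightarrow> bool" where
  "left_ideal R I \<longleftrightarrow>
     additive_subgroup I R \<and> (\<forall>r\<in>carrier R. \<forall>x\<in>I. r \<otimes>\<^bsub>R\<^esub> x \<in> I)"

definition verma_ideal :: "complex \<Rightarrow> complex \<Rightarrow> vir free_algebra set set" where
  "verma_ideal c h = left_ideal enveloping_ring hull
     ({env_class (gen (D i)) | i. i > 0} \<union>
      {env_class (gen (D 0) - scalar h), env_class (gen Z - scalar c)})"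

definition verma :: "complex \<Rightarrow> complex \<Rightarrow> (vir, vir free_algebra set set) rep" where
  "verma c h = quotient_module enveloping_module (verma_ideal c h)"

text \<open>The module \<open>A\<^bsub>a,b\<^esub>\<close> has underlying space \<^typ>\<open>int \<Rightarrow>\<^sub>0 complex\<close>, where \<open>v\<^sub>n\<close> is
  \<open>single n 1\<close>.\<close>

definition intermediate_module ::
  "complex \<Rightarrow> complex \<Rightarrow> (vir, int \<Rightarrow>\<^sub>0 complex) rep" where
  "intermediate_module a b =
     \<lparr>carrier = UNIV, monoid.mult = undefined, one = undefined, zero = 0, add = (+),
      module.smult = (\<lambda>c. Poly_Mapping.map ((*) c)),
      act = (\<lambda>x p. case x of
               D m \<Rightarrow> (\<Sum>n\<in>Poly_Mapping.keys p. Poly_Mapping.single (n + m)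
                         ((a + of_int n + b * of_int m) * Poly_Mapping.lookup p n))
             | Z \<Rightarrow> 0)\<rparr>"

text \<open>The nontrivial simple subquotient of \<open>A\<^bsub>a,b\<^esub>\<close>. The module \<open>A\<^bsub>a,b\<^esub>\<close> is simple unless \<open>a\<close> is an
  integer and \<open>b\<close> is 0 or 1. Submodules are written as quotients by the zero submodule, so that
  all cases have the same type.\<close>

definition intermediate_simple ::
  "complex \<Rightarrow> complex \<Rightarrow> (vir, (int \<Rightarrow>\<^sub>0 complex) set) rep" where
  "intermediate_simple a b =
     (let A = intermediate_module a b in
      if a \<in> \<int> \<and> b = 0 then
        quotient_module A {p. \<forall>n\<in>Poly_Mapping.keys p. of_int n = - a}
      else if a \<in> \<int> \<and> b = 1 then
        quotient_module (A\<lparr>carrier := {p. \<forall>n\<in>Poly_Mapping.keys p. of_int n \<noteq> - a}\<rparr>) {0}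
      else quotient_module A {0})"

end

theory Submission
  imports Defs
begin

text \<open>
  Suppose that one of the modules \<open>L\<close> embeds in \<open>V \<otimes> A'\<close>, where \<open>V\<close> is the simple highest weight
  module and \<open>A'\<close> is the simple module of the intermediate series. The contradiction comes from
  looking at the vectors \<open>d\<^sub>-\<^sub>l (d\<^sub>l x)\<close> for a fixed weight vector \<open>x\<close> and growing \<open>l\<close>.

  In a loop module the operator \<open>d\<^sub>l\<close> acts on \<open>w \<otimes> t\<^sup>j\<close> through finitely many vectors of \<open>W\<close> whose
  coefficients depend on \<open>l\<close>, so all \<open>d\<^sub>-\<^sub>l (d\<^sub>l x)\<close> lie in a finite-dimensional space
  (\<open>loop_coeff_in_span\<close>). For the two halves of the loop module at \<open>- 1\<close> and even \<open>l\<close> they are even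
  multiples of \<open>x\<close> when \<open>x = w \<otimes> t\<^sup>e\<close>.

  In \<open>V \<otimes> A'\<close>, write \<open>x\<close> as a sum of \<open>u\<^sub>n \<otimes> v\<^sub>n\<close> and let \<open>i\<close> be the largest index that occurs. For
  large \<open>l\<close> the operator \<open>d\<^sub>l\<close> kills every \<open>u\<^sub>n\<close>, and the component of \<open>d\<^sub>-\<^sub>l (d\<^sub>l x)\<close> at \<open>v\<^sub>i\<^sub>+\<^sub>l\<close> is a
  nonzero multiple of \<open>d\<^sub>-\<^sub>l u\<^sub>i\<close>. If \<open>V\<close> is not trivial, a nonzero vector of \<open>V\<close> is killed by only
  finitely many \<open>d\<^sub>-\<^sub>l\<close> (\<open>lowering_dichotomy\<close>), so these vectors have ever larger leading positions
  and span an infinite-dimensional space (\<open>lowering_raising_infinite\<close>). Hence \<open>V\<close> is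
  one-dimensional and trivial, and \<open>V \<otimes> A' \<cong> A'\<close> has weight spaces of dimension at most 1
  (\<open>weight_spaces_one_dimensional\<close>).

  But the weight spaces of \<open>L\<close> are larger. Those of the full loop module are copies of \<open>W\<close>, which
  has dimension at least 2 because the Lie algebra is perfect and acts nontrivially
  (\<open>one_dimensional_trivial\<close>). In a half, \<open>w \<otimes> t\<^sup>e\<close> and \<open>d\<^sub>1 (d\<^sub>1 (w \<otimes> t\<^sup>e\<^sup>-\<^sup>2))\<close> have the same weight and
  are independent: the second contains the second derivative of \<open>w\<close>, which \<open>d\<^sub>2\<close> maps to \<open>6 b w\<close>
  (\<open>comb_independent\<close>).

  To compute with \<open>V\<close>, \<open>A'\<close> and their tensor product, all of which are iterated quotients, each is
  identified with a subspace of a type: \<open>V\<close> with a complement of a maximal left ideal in the free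
  algebra, \<open>A'\<close> with finitely supported functions on a set of integers, and the tensor product with
  finitely supported functions from the integers to the free algebra.
\<close>

section \<open>Presentations and embeddings of modules\<close>

lemma ring_of_type_algebra_simps [simp]:
  "carrier (ring_of_type_algebra :: 'a::ring_1 ring) = UNIV"
  "x \<oplus>\<^bsub>(ring_of_type_algebra :: 'a ring)\<^esub> y = x + y"
  "x \<otimes>\<^bsub>(ring_of_type_algebra :: 'a ring)\<^esub> y = x * y"
  "\<zero>\<^bsub>(ring_of_type_algebra :: 'a ring)\<^esub> = 0"
  "\<one>\<^bsub>(ring_of_type_algebra :: 'a ring)\<^esub> = 1"
  by (simp_all add: ring_of_type_algebra_def)

text \<open>A module built from iterated quotients has elements that are sets of sets, on which direct
  computation is painful. A presentation replaces it by a subspace \<open>E\<close> of a type that is a vector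
  space and a surjection \<open>\<pi>\<close> from \<open>E\<close> that respects all operations; \<open>T\<close> lifts the Lie algebra
  action to \<open>E\<close>. Quotients keep \<open>E\<close> and \<open>T\<close> and enlarge only the kernel of \<open>\<pi>\<close>, so that a chain
  of quotients is never seen again.\<close>

locale linear_presentation = vector_space s
  for s :: "complex \<Rightarrow> 'e::ab_group_add \<Rightarrow> 'e" +
  fixes M :: "('g, 'v) rep" and E :: "'e set" and \<pi> :: "'e \<Rightarrow> 'v"
    and T :: "'g \<Rightarrow> 'e \<Rightarrow> 'e"
  assumes E_subspace: "subspace E"
    and T_closed: "x \<in> E \<Longrightarrow> T g x \<in> E"
    and T_add: "x \<in> E \<Longrightarrow> y \<in> E \<Longrightarrow> T g (x + y) = T g x + T g y"
    and carrier_eq: "carrier M = \<pi> ` E"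
    and zero_eq: "\<zero>\<^bsub>M\<^esub> = \<pi> 0"
    and add_eq: "x \<in> E \<Longrightarrow> y \<in> E \<Longrightarrow> \<pi> x \<oplus>\<^bsub>M\<^esub> \<pi> y = \<pi> (x + y)"
    and smult_eq: "x \<in> E \<Longrightarrow> c \<odot>\<^bsub>M\<^esub> \<pi> x = \<pi> (s c x)"
    and act_eq: "x \<in> E \<Longrightarrow> act M g (\<pi> x) = \<pi> (T g x)"
begin

lemma E_zero: "0 \<in> E" and E_add: "x \<in> E \<Longrightarrow> y \<in> E \<Longrightarrow> x + y \<in> E"
  and E_scale: "x \<in> E \<Longrightarrow> s c x \<in> E" and E_diff: "x \<in> E \<Longrightarrow> y \<in> E \<Longrightarrow> x - y \<in> E"
  and E_neg: "x \<in> E \<Longrightarrow> - x \<in> E"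
  using E_subspace by (auto simp: subspace_0 subspace_add subspace_scale subspace_diff subspace_neg)

lemma eq_iff: "x \<in> E \<Longrightarrow> y \<in> E \<Longrightarrow> \<pi> x = \<pi> y \<longleftrightarrow> \<pi> (x - y) = \<pi> 0"
proof
  assume xy: "x \<in> E" "y \<in> E"
  { assume "\<pi> x = \<pi> y"
    then have "\<pi> x \<oplus>\<^bsub>M\<^esub> \<pi> (- y) = \<pi> y \<oplus>\<^bsub>M\<^esub> \<pi> (- y)" by simp
    then show "\<pi> (x - y) = \<pi> 0" using xy by (simp add: add_eq E_neg) }
  { assume "\<pi> (x - y) = \<pi> 0"
    then have "\<pi> (x - y) \<oplus>\<^bsub>M\<^esub> \<pi> y = \<pi> 0 \<oplus>\<^bsub>M\<^esub> \<pi> y" by simp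
    then show "\<pi> x = \<pi> y" using xy by (simp add: add_eq E_diff E_zero) }
qed

lemma presented_module: "Module.module complex_ring M"
proof (rule moduleI)
  show "cring complex_ring" by (rule cring_from_type_algebra)
  show "abelian_group M"
  proof (rule abelian_groupI)
    fix x assume "x \<in> carrier M"
    then obtain u where u: "u \<in> E" "x = \<pi> u" by (auto simp: carrier_eq)
    show "\<exists>y\<in>carrier M. y \<oplus>\<^bsub>M\<^esub> x = \<zero>\<^bsub>M\<^esub>"
      by (rule bexI[of _ "\<pi> (- u)"]) (use u in \<open>auto simp: carrier_eq add_eq zero_eq E_neg\<close>)
  qed (auto simp: carrier_eq add_eq zero_eq E_zero E_add ac_simps)
qed (auto simp: carrier_eq add_eq zero_eq E_zero E_add E_scale smult_eq algebra_simps)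

text \<open>The quotient by a submodule \<open>N\<close> is presented by the same space: the coset of \<open>\<pi> x\<close> is the
  image under \<open>\<pi>\<close> of the translate of the preimage \<open>K\<close> of \<open>N\<close>, and \<open>T\<close> being additive makes all
  the unions over representatives constant.\<close>

lemma presented_quotient:
  assumes N: "N \<subseteq> carrier M" and N0: "\<zero>\<^bsub>M\<^esub> \<in> N"
    and Nadd: "\<And>x y. x \<in> N \<Longrightarrow> y \<in> N \<Longrightarrow> x \<oplus>\<^bsub>M\<^esub> y \<in> N"
    and Nsmult: "\<And>c x. x \<in> N \<Longrightarrow> c \<odot>\<^bsub>M\<^esub> x \<in> N"
    and Nact: "\<And>g x. x \<in> N \<Longrightarrow> act M g x \<in> N"
  shows "linear_presentation s (quotient_module M N) E (\<lambda>x. N +>\<^bsub>M\<^esub> \<pi> x) T"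
    and "\<And>x y. x \<in> E \<Longrightarrow> y \<in> E \<Longrightarrow> N +>\<^bsub>M\<^esub> \<pi> x = N +>\<^bsub>M\<^esub> \<pi> y \<longleftrightarrow> \<pi> (x - y) \<in> N"
proof -
  define K where "K = {x \<in> E. \<pi> x \<in> N}"
  have KE: "x \<in> K \<Longrightarrow> x \<in> E" for x by (simp add: K_def)
  have N_eq: "N = \<pi> ` K" using N by (auto simp: K_def carrier_eq)
  have K0: "0 \<in> K" using N0 by (simp add: K_def E_zero zero_eq)
  have Kadd: "x \<in> K \<Longrightarrow> y \<in> K \<Longrightarrow> x + y \<in> K" for x y
    using Nadd by (auto simp: K_def E_add simp flip: add_eq)
  have Ks: "x \<in> K \<Longrightarrow> s c x \<in> K" for x c
    using Nsmult by (auto simp: K_def E_scale simp flip: smult_eq)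
  have Kneg: "x \<in> K \<Longrightarrow> - x \<in> K" for x
    using Ks[of x "-1"] by simp
  have KT: "x \<in> K \<Longrightarrow> T g x \<in> K" for x g
    using Nact by (auto simp: K_def T_closed simp flip: act_eq)
  have coset: "N +>\<^bsub>M\<^esub> \<pi> x = {\<pi> (k + x) | k. k \<in> K}" if "x \<in> E" for x
    using that by (force simp: a_r_coset_def' N_eq add_eq KE)
  have ker0: "\<pi> z = \<pi> 0 \<Longrightarrow> z \<in> E \<Longrightarrow> z \<in> K" for z
    using N0 by (simp add: K_def zero_eq)
  have sub: "N +>\<^bsub>M\<^esub> \<pi> x \<subseteq> N +>\<^bsub>M\<^esub> \<pi> y" if "x \<in> E" "y \<in> E" "x - y \<in> K" for x y
  proof -
    have "\<exists>k'. k + x = k' + y \<and> k' \<in> K" if "k \<in> K" for k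
      by (rule exI[of _ "k + (x - y)"]) (simp add: Kadd that \<open>x - y \<in> K\<close>)
    then have "\<exists>k'. \<pi> (k + x) = \<pi> (k' + y) \<and> k' \<in> K" if "k \<in> K" for k using that by metis
    then show ?thesis using that by (auto simp: coset)
  qed
  have eqK: "N +>\<^bsub>M\<^esub> \<pi> x = N +>\<^bsub>M\<^esub> \<pi> y \<longleftrightarrow> x - y \<in> K" if xy: "x \<in> E" "y \<in> E" for x y
  proof
    assume "x - y \<in> K"
    moreover from Kneg[OF this] have "y - x \<in> K" by simp
    ultimately show "N +>\<^bsub>M\<^esub> \<pi> x = N +>\<^bsub>M\<^esub> \<pi> y" using sub xy by blast
  next
    assume eq: "N +>\<^bsub>M\<^esub> \<pi> x = N +>\<^bsub>M\<^esub> \<pi> y"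
    have "\<pi> x \<in> N +>\<^bsub>M\<^esub> \<pi> x" using K0 xy by (force simp: coset)
    then obtain k where k: "k \<in> K" "\<pi> x = \<pi> (k + y)" using eq xy by (auto simp: coset)
    then have "\<pi> (x - (k + y)) = \<pi> 0" using eq_iff[of x "k + y"] xy KE E_add by auto
    then have "x - (k + y) \<in> K" using ker0 xy k KE E_add E_diff by auto
    from Kadd[OF this k(1)] show "x - y \<in> K" by simp
  qed
  show "\<And>x y. x \<in> E \<Longrightarrow> y \<in> E \<Longrightarrow> N +>\<^bsub>M\<^esub> \<pi> x = N +>\<^bsub>M\<^esub> \<pi> y \<longleftrightarrow> \<pi> (x - y) \<in> N"
    by (simp add: eqK K_def E_diff)
  have un: "(\<Union>z\<in>N +>\<^bsub>M\<^esub> \<pi> x. N +>\<^bsub>M\<^esub> h z) = N +>\<^bsub>M\<^esub> \<pi> (f x)"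
    if x: "x \<in> E" and h: "\<And>y. y \<in> E \<Longrightarrow> h (\<pi> y) = \<pi> (f y)" and fK: "\<And>y. y \<in> K \<Longrightarrow> f y \<in> K"
      and f: "\<And>y. y \<in> E \<Longrightarrow> f y \<in> E" "\<And>y z. y \<in> E \<Longrightarrow> z \<in> E \<Longrightarrow> f (y + z) = f y + f z" for x h f
  proof -
    have "N +>\<^bsub>M\<^esub> h z = N +>\<^bsub>M\<^esub> \<pi> (f x)" if "z \<in> N +>\<^bsub>M\<^esub> \<pi> x" for z
    proof -
      from that x obtain k where k: "k \<in> K" "z = \<pi> (k + x)" by (auto simp: coset)
      then show ?thesis using x by (simp add: h f KE E_add eqK fK)
    qed
    moreover have "N +>\<^bsub>M\<^esub> \<pi> x \<noteq> {}" using K0 x by (auto simp: coset)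
    ultimately show ?thesis by auto
  qed
  show "linear_presentation s (quotient_module M N) E (\<lambda>x. N +>\<^bsub>M\<^esub> \<pi> x) T"
  proof
    show "carrier (quotient_module M N) = (\<lambda>x. N +>\<^bsub>M\<^esub> \<pi> x) ` E"
      by (auto simp: quotient_module_def A_RCOSETS_def' carrier_eq)
    have "N +>\<^bsub>M\<^esub> \<pi> 0 = N" using coset[OF E_zero] by (auto simp: N_eq)
    then show "\<zero>\<^bsub>quotient_module M N\<^esub> = N +>\<^bsub>M\<^esub> \<pi> 0"
      by (simp add: quotient_module_def)
    fix x y c g assume x: "x \<in> E"
    show "c \<odot>\<^bsub>quotient_module M N\<^esub> (N +>\<^bsub>M\<^esub> \<pi> x) = N +>\<^bsub>M\<^esub> \<pi> (s c x)"
      using un[OF x, of "\<lambda>y. c \<odot>\<^bsub>M\<^esub> y" "s c"] x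
      by (simp add: quotient_module_def smult_eq Ks E_scale scale_right_distrib)
    show "act (quotient_module M N) g (N +>\<^bsub>M\<^esub> \<pi> x) = N +>\<^bsub>M\<^esub> \<pi> (T g x)"
      using un[OF x, of "\<lambda>y. act M g y" "T g"] x
      by (simp add: quotient_module_def act_eq KT T_closed T_add)
    assume y: "y \<in> E"
    have "(N +>\<^bsub>M\<^esub> \<pi> x) <+>\<^bsub>M\<^esub> (N +>\<^bsub>M\<^esub> \<pi> y) = N +>\<^bsub>M\<^esub> \<pi> (x + y)"
    proof -
      have *: "\<pi> (k + x) \<oplus>\<^bsub>M\<^esub> \<pi> (k' + y) = \<pi> ((k + k') + (x + y))"
        if "k \<in> K" "k' \<in> K" for k k'
        using x y that by (simp add: add_eq KE E_add ac_simps)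
      have "(N +>\<^bsub>M\<^esub> \<pi> x) <+>\<^bsub>M\<^esub> (N +>\<^bsub>M\<^esub> \<pi> y)
          = {\<pi> ((k + k') + (x + y)) | k k'. k \<in> K \<and> k' \<in> K}"
        unfolding set_add_def' coset[OF x] coset[OF y] by (force simp flip: *)
      also have "\<dots> = {\<pi> (k + (x + y)) | k. k \<in> K}"
      proof (intro equalityI subsetI)
        fix z assume "z \<in> {\<pi> (k + (x + y)) | k. k \<in> K}"
        then obtain k where "z = \<pi> ((k + 0) + (x + y))" "k \<in> K" by auto
        then show "z \<in> {\<pi> ((k + k') + (x + y)) | k k'. k \<in> K \<and> k' \<in> K}" using K0 by blast
      qed (use Kadd in blast)
      finally show ?thesis using x y by (simp add: coset E_add)
    qed
    then show "(N +>\<^bsub>M\<^esub> \<pi> x) \<oplus>\<^bsub>quotient_module M N\<^esub> (N +>\<^bsub>M\<^esub> \<pi> y) = N +>\<^bsub>M\<^esub> \<pi> (x + y)"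
      by (simp add: quotient_module_def)
  qed (simp_all add: E_subspace T_closed T_add)
qed

end

text \<open>The dual device: an injective linear map into a type turns identities in the module into
  identities in the type.\<close>

locale vector_embedding =
  fixes M :: "('g, 'v) rep" and s :: "complex \<Rightarrow> 'e::ab_group_add \<Rightarrow> 'e" and \<iota> :: "'v \<Rightarrow> 'e"
  assumes zero_closed: "\<zero>\<^bsub>M\<^esub> \<in> carrier M"
    and add_closed: "x \<in> carrier M \<Longrightarrow> y \<in> carrier M \<Longrightarrow> x \<oplus>\<^bsub>M\<^esub> y \<in> carrier M"
    and smult_closed: "x \<in> carrier M \<Longrightarrow> c \<odot>\<^bsub>M\<^esub> x \<in> carrier M"
    and act_closed: "x \<in> carrier M \<Longrightarrow> act M g x \<in> carrier M"
    and emb_zero: "\<iota> \<zero>\<^bsub>M\<^esub> = 0"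
    and emb_add: "x \<in> carrier M \<Longrightarrow> y \<in> carrier M \<Longrightarrow> \<iota> (x \<oplus>\<^bsub>M\<^esub> y) = \<iota> x + \<iota> y"
    and emb_smult: "x \<in> carrier M \<Longrightarrow> \<iota> (c \<odot>\<^bsub>M\<^esub> x) = s c (\<iota> x)"
    and emb_inj: "inj_on \<iota> (carrier M)"

text \<open>A linear map on the presenting space with the same kernel as \<open>\<pi>\<close> factors through an
  embedding. This is how quotients become subspaces below.\<close>

lemma (in linear_presentation) embedding_of_linear_map:
  fixes L :: "'e \<Rightarrow> 'f::ab_group_add" and s' :: "complex \<Rightarrow> 'f \<Rightarrow> 'f"
  assumes L_add: "\<And>x y. x \<in> E \<Longrightarrow> y \<in> E \<Longrightarrow> L (x + y) = L x + L y"
    and L_scale: "\<And>c x. x \<in> E \<Longrightarrow> L (s c x) = s' c (L x)"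
    and ker: "\<And>x. x \<in> E \<Longrightarrow> L x = 0 \<longleftrightarrow> \<pi> x = \<pi> 0"
  obtains \<iota> where "vector_embedding M s' \<iota>" "\<And>x. x \<in> E \<Longrightarrow> \<iota> (\<pi> x) = L x"
proof -
  define \<iota> where "\<iota> v = L (SOME x. x \<in> E \<and> \<pi> x = v)" for v
  have L_diff: "L (x - y) = L x - L y" if "x \<in> E" "y \<in> E" for x y
    using L_add[OF E_diff[OF that] that(2)] by simp
  have L_eq: "L x = L y \<longleftrightarrow> \<pi> x = \<pi> y" if "x \<in> E" "y \<in> E" for x y
    using ker[OF E_diff[OF that]] eq_iff[OF that] L_diff[OF that] by simp
  have io: "\<iota> (\<pi> x) = L x" if "x \<in> E" for x
  proof -
    have "(SOME y. y \<in> E \<and> \<pi> y = \<pi> x) \<in> E \<and> \<pi> (SOME y. y \<in> E \<and> \<pi> y = \<pi> x) = \<pi> x"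
      by (rule someI[of _ x]) (use that in auto)
    then show ?thesis unfolding \<iota>_def using L_eq that by blast
  qed
  have "vector_embedding M s' \<iota>"
    by unfold_locales
      (auto simp: carrier_eq zero_eq add_eq smult_eq act_eq E_zero E_add E_scale T_closed io L_add
        L_scale ker inj_on_def L_eq)
  then show ?thesis using io that by blast
qed

section \<open>Finitely supported functions and linear spans\<close>

abbreviation lookup where "lookup \<equiv> Poly_Mapping.lookup"
abbreviation keys where "keys \<equiv> Poly_Mapping.keys"
abbreviation single where "single \<equiv> Poly_Mapping.single"

lemma lookup_map_times [simp]:
  "lookup (Poly_Mapping.map ((*) (c::complex)) p) k = c * lookup p k"
  by (simp add: map.rep_eq when_def)

interpretation pm: vector_space "\<lambda>c::complex. Poly_Mapping.map ((*) c)"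
  by unfold_locales (auto intro!: poly_mapping_eqI simp: lookup_add algebra_simps)

lemma keys_map_times: "keys (Poly_Mapping.map ((*) (c::complex)) p) \<subseteq> keys p"
  by (auto simp: in_keys_iff)

lemma subspace_keys: "pm.subspace {p. keys p \<subseteq> S}"
proof (rule pm.subspaceI)
  fix p q :: "'a \<Rightarrow>\<^sub>0 complex" and c assume "p \<in> {p. keys p \<subseteq> S}"
  then show "Poly_Mapping.map ((*) c) p \<in> {p. keys p \<subseteq> S}"
    using keys_map_times[of c p] by auto
  assume "q \<in> {p. keys p \<subseteq> S}" with \<open>p \<in> _\<close> show "p + q \<in> {p. keys p \<subseteq> S}"
    using keys_add[of p q] by auto
qed simp

text \<open>Finitely supported functions are generated by the monomials with coefficients; the
  induction keeps track of the support.\<close>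

lemma poly_mapping_keys_induct [consumes 1, case_names zero single add]:
  fixes p :: "'a \<Rightarrow>\<^sub>0 'b::comm_monoid_add"
  assumes "keys p \<subseteq> S" and "P 0" and sng: "\<And>x c. x \<in> S \<Longrightarrow> P (single x c)"
    and add: "\<And>p q. keys p \<subseteq> S \<Longrightarrow> keys q \<subseteq> S \<Longrightarrow> P p \<Longrightarrow> P q \<Longrightarrow> P (p + q)"
  shows "P p"
proof -
  have eq: "p = (\<Sum>x\<in>keys p. single x (lookup p x))" for p :: "'a \<Rightarrow>\<^sub>0 'b"
    by (rule poly_mapping_eqI) (auto simp: lookup_sum lookup_single when_def in_keys_iff)
  have "keys (\<Sum>x\<in>B. single x (lookup p x)) \<subseteq> S \<and>
        P (\<Sum>x\<in>B. single x (lookup p x))" if "finite B" "B \<subseteq> S" for B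
    using that
  proof (induction B)
    case (insert x B)
    have 1: "keys (single x (lookup p x)) \<subseteq> S" and 2: "P (single x (lookup p x))"
      using insert.prems sng by auto
    have IH: "keys (\<Sum>x\<in>B. single x (lookup p x)) \<subseteq> S" "P (\<Sum>x\<in>B. single x (lookup p x))"
      using insert by auto
    show ?case
      unfolding sum.insert[OF insert.hyps]
      using add[OF 1 IH(1) 2 IH(2)] order_trans[OF keys_add Un_least[OF 1 IH(1)]] by blast
  qed (use \<open>P 0\<close> in simp)
  from this[of "keys p"] assms(1) show ?thesis using eq[of p] by simp
qed

definition additive_ext :: "('a \<Rightarrow> complex \<Rightarrow> 'f) \<Rightarrow> ('a \<Rightarrow>\<^sub>0 complex) \<Rightarrow> 'f::ab_group_add" where
  "additive_ext h p = (\<Sum>x\<in>keys p. h x (lookup p x))"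

locale additive_family =
  fixes h :: "'a \<Rightarrow> complex \<Rightarrow> 'f::ab_group_add"
  assumes h_add: "h x (c + d) = h x c + h x d"
begin

lemma h_zero [simp]: "h x 0 = 0"
  using h_add[of x 0 0] by simp

lemma ext_add: "additive_ext h (p + q) = additive_ext h p + additive_ext h q"
  unfolding additive_ext_def by (rule setsum_keys_plus_distrib) (simp_all add: h_add)

lemma ext_single [simp]: "additive_ext h (single x c) = h x c"
  by (simp add: additive_ext_def)

lemma ext_zero [simp]: "additive_ext h 0 = 0"
  by (simp add: additive_ext_def)

lemma ext_neg: "additive_ext h (- p) = - additive_ext h p"
  using ext_add[of p "- p"] by (simp add: eq_neg_iff_add_eq_0 add.commute)

lemma ext_diff: "additive_ext h (p - q) = additive_ext h p - additive_ext h q"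
  using ext_add[of p "- q"] by (simp add: ext_neg)

lemma ext_sum: "additive_ext h (\<Sum>i\<in>I. f i) = (\<Sum>i\<in>I. additive_ext h (f i))"
  by (induction I rule: infinite_finite_induct) (simp_all add: ext_add)

end

lemma submodule_closed:
  assumes "submodule N complex_ring M"
  shows "N \<subseteq> carrier M" "\<zero>\<^bsub>M\<^esub> \<in> N" "\<And>x y. x \<in> N \<Longrightarrow> y \<in> N \<Longrightarrow> x \<oplus>\<^bsub>M\<^esub> y \<in> N"
    "\<And>c x. x \<in> N \<Longrightarrow> c \<odot>\<^bsub>M\<^esub> x \<in> N"
proof -
  interpret submodule N complex_ring M by fact
  show "N \<subseteq> carrier M" "\<zero>\<^bsub>M\<^esub> \<in> N" "\<And>x y. x \<in> N \<Longrightarrow> y \<in> N \<Longrightarrow> x \<oplus>\<^bsub>M\<^esub> y \<in> N"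
    "\<And>c x. x \<in> N \<Longrightarrow> c \<odot>\<^bsub>M\<^esub> x \<in> N"
    using subset one_closed m_closed smult_closed by auto
qed

lemma linear_span_inc: "B \<subseteq> linear_span M B"
  by (simp add: linear_span_def hull_subset)

lemma linear_span_closed:
  shows "\<zero>\<^bsub>M\<^esub> \<in> linear_span M B"
    "x \<in> linear_span M B \<Longrightarrow> y \<in> linear_span M B \<Longrightarrow> x \<oplus>\<^bsub>M\<^esub> y \<in> linear_span M B"
    "x \<in> linear_span M B \<Longrightarrow> c \<odot>\<^bsub>M\<^esub> x \<in> linear_span M B"
  unfolding linear_span_def hull_def using submodule_closed[of _ M] by auto

lemma linear_span_minimal: "submodule S complex_ring M \<Longrightarrow> B \<subseteq> S \<Longrightarrow> linear_span M B \<subseteq> S"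
  unfolding linear_span_def by (rule hull_minimal)

lemma (in linear_presentation) submodule_image:
  assumes "subspace S" "S \<subseteq> E"
  shows "submodule (\<pi> ` S) complex_ring M"
proof -
  interpret Module.module complex_ring M by (rule presented_module)
  show ?thesis
  proof (rule submoduleI)
    show "\<ominus>\<^bsub>M\<^esub> a \<in> \<pi> ` S" if "a \<in> \<pi> ` S" for a
    proof -
      from that obtain x where x: "x \<in> S" "a = \<pi> x" by auto
      have "\<ominus>\<^bsub>M\<^esub> a = \<pi> (- x)"
        by (rule minus_equality) (use x assms in \<open>auto simp: add_eq E_neg zero_eq carrier_eq\<close>)
      then show ?thesis using x subspace_neg[OF assms(1)] by simp
    qed
  qed (use assms in \<open>auto simp: carrier_eq zero_eq subspace_0 add_eq smult_eq subspace_add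
        subspace_scale subset_iff\<close>)
qed

section \<open>Coordinates on a tensor product\<close>

text \<open>The second factor \<open>N\<close> is a space of finitely supported functions on \<open>J\<close> on which the Lie
  algebra acts by weighted shifts, as it does on the intermediate series. Then \<open>M \<otimes> N\<close> is a direct
  sum of copies of \<open>M\<close> indexed by \<open>J\<close>, and the map \<open>\<Theta>\<close> below reads off the components.\<close>

locale tensor_embedding =
  vector_space s + M: vector_embedding M s \<iota> +
  N: vector_embedding N "\<lambda>c::complex. Poly_Mapping.map ((*) c)" \<beta>
  for s :: "complex \<Rightarrow> 'e::ab_group_add \<Rightarrow> 'e" and M :: "('g, 'u) rep" and \<iota> :: "'u \<Rightarrow> 'e"
    and N :: "('g, 'v) rep" and \<beta> :: "'v \<Rightarrow> (int \<Rightarrow>\<^sub>0 complex)" +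
  fixes J :: "int set" and A :: "'g \<Rightarrow> 'e \<Rightarrow> 'e"
    and \<kappa> :: "'g \<Rightarrow> int \<Rightarrow> complex" and deg :: "'g \<Rightarrow> int"
  assumes image: "\<beta> ` carrier N = {q. keys q \<subseteq> J}"
    and A_linear: "A g (x + y) = A g x + A g y" "A g (s c x) = s c (A g x)"
    and act_M: "u \<in> carrier M \<Longrightarrow> \<iota> (act M g u) = A g (\<iota> u)"
    and act_N: "v \<in> carrier N \<Longrightarrow> lookup (\<beta> (act N g v)) n = \<kappa> g n * lookup (\<beta> v) (n - deg g)"
begin

abbreviation "F \<equiv> free_pairs M N"
abbreviation "R \<equiv> linear_span F (bilinear_relations M N)"
abbreviation "E \<equiv> {p :: ('u \<times> 'v) \<Rightarrow>\<^sub>0 complex. keys p \<subseteq> carrier M \<times> carrier N}"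

definition pure_tensor :: "'u \<times> 'v \<Rightarrow> complex \<Rightarrow> int \<Rightarrow>\<^sub>0 'e" where
  "pure_tensor x c = Poly_Mapping.map (\<lambda>d. s (c * d) (\<iota> (fst x))) (\<beta> (snd x))"

abbreviation "\<Theta> \<equiv> additive_ext pure_tensor"

lemma lookup_pure_tensor: "lookup (pure_tensor x c) n = s (c * lookup (\<beta> (snd x)) n) (\<iota> (fst x))"
  by (simp add: pure_tensor_def map.rep_eq when_def)

sublocale pure_tensor: additive_family pure_tensor
  by unfold_locales
    (auto intro!: poly_mapping_eqI simp: lookup_pure_tensor lookup_add scale_left_distrib algebra_simps)

lemma A_zero: "A g 0 = 0"
  using A_linear(1)[of g 0 0] by simp

lemma lookup_\<Theta>: "lookup (\<Theta> p) n = (\<Sum>x\<in>keys p. s (lookup p x * lookup (\<beta> (snd x)) n) (\<iota> (fst x)))"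
  by (simp add: additive_ext_def lookup_sum lookup_pure_tensor)

lemma \<Theta>_scale: "lookup (\<Theta> (Poly_Mapping.map ((*) c) p)) n = s c (lookup (\<Theta> p) n)"
proof -
  have "lookup (\<Theta> (Poly_Mapping.map ((*) c) p)) n
      = (\<Sum>x\<in>keys p. s (c * lookup p x * lookup (\<beta> (snd x)) n) (\<iota> (fst x)))"
    unfolding lookup_\<Theta> by (rule sum.mono_neutral_cong_left) (auto simp: in_keys_iff)
  also have "\<dots> = s c (lookup (\<Theta> p) n)"
    unfolding lookup_\<Theta> scale_sum_right by (simp add: ac_simps)
  finally show ?thesis .
qed

definition leibniz :: "'g \<Rightarrow> 'u \<times> 'v \<Rightarrow> complex \<Rightarrow> ('u \<times> 'v) \<Rightarrow>\<^sub>0 complex" where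
  "leibniz g x c = single (act M g (fst x), snd x) c
     + single (fst x, act N g (snd x)) c"

sublocale leibniz: additive_family "leibniz g"
  by unfold_locales (simp add: leibniz_def single_add algebra_simps)

lemma act_free: "act F g p = additive_ext (leibniz g) p"
  by (simp add: free_pairs_def additive_ext_def leibniz_def case_prod_beta)

lemma F_simps:
  "carrier F = E" "\<zero>\<^bsub>F\<^esub> = 0" "p \<oplus>\<^bsub>F\<^esub> q = p + q" "c \<odot>\<^bsub>F\<^esub> p = Poly_Mapping.map ((*) c) p"
  by (simp_all add: free_pairs_def)

lemma E_single: "u \<in> carrier M \<Longrightarrow> v \<in> carrier N \<Longrightarrow> single (u, v) c \<in> E"
  by simp

sublocale F: linear_presentation "\<lambda>c::complex. Poly_Mapping.map ((*) c)" F E "\<lambda>x. x" "act F"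
proof unfold_locales
  show "pm.subspace E" by (rule subspace_keys)
  then have E_add: "x \<in> E \<Longrightarrow> y \<in> E \<Longrightarrow> x + y \<in> E" for x y by (rule pm.subspace_add)
  show "act F g p \<in> E" if "p \<in> E" for g p
  proof -
    have "keys p \<subseteq> carrier M \<times> carrier N" using that by simp
    then show ?thesis
    proof (induction p rule: poly_mapping_keys_induct)
      case (single x c)
      then show ?case
        unfolding act_free leibniz.ext_single leibniz_def
        by (intro E_add E_single) (auto simp: M.act_closed N.act_closed)
    next
      case (add p q)
      then show ?case using E_add unfolding act_free leibniz.ext_add by blast
    qed (simp add: act_free)
  qed
qed (auto simp: F_simps act_free leibniz.ext_add)

lemma R_add: "p \<in> R \<Longrightarrow> q \<in> R \<Longrightarrow> p + q \<in> R"
  using linear_span_closed(2)[of p F _ q] by (simp add: F_simps)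

lemma R_scale: "p \<in> R \<Longrightarrow> Poly_Mapping.map ((*) c) p \<in> R"
  using linear_span_closed(3)[of p F _ c] by (simp add: F_simps)

lemma R_zero: "0 \<in> R"
  using linear_span_closed(1)[of F] by (simp add: F_simps)

lemma R_neg: "p \<in> R \<Longrightarrow> - p \<in> R"
  using R_scale[of p "-1"] pm.scale_minus_left[of 1 p] by simp

lemma R_diff: "p \<in> R \<Longrightarrow> q \<in> R \<Longrightarrow> p - q \<in> R"
  using R_add[of p "- q"] R_neg by simp

lemma R_sum: "(\<And>i. i \<in> I \<Longrightarrow> f i \<in> R) \<Longrightarrow> (\<Sum>i\<in>I. f i) \<in> R"
  by (induction I rule: infinite_finite_induct) (auto simp: R_zero R_add)

lemma relation_add_left: "u \<in> carrier M \<Longrightarrow> u' \<in> carrier M \<Longrightarrow> v \<in> carrier N \<Longrightarrow>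
    single (u \<oplus>\<^bsub>M\<^esub> u', v) 1 - single (u, v) 1 - single (u', v) 1 \<in> R"
  and relation_add_right: "u \<in> carrier M \<Longrightarrow> v \<in> carrier N \<Longrightarrow> v' \<in> carrier N \<Longrightarrow>
    single (u, v \<oplus>\<^bsub>N\<^esub> v') 1 - single (u, v) 1 - single (u, v') 1 \<in> R"
  and relation_smult_left: "u \<in> carrier M \<Longrightarrow> v \<in> carrier N \<Longrightarrow>
    single (c \<odot>\<^bsub>M\<^esub> u, v) 1 - single (u, v) c \<in> R"
  and relation_smult_right: "u \<in> carrier M \<Longrightarrow> v \<in> carrier N \<Longrightarrow>
    single (u, c \<odot>\<^bsub>N\<^esub> v) 1 - single (u, v) c \<in> R"
  by (rule subsetD[OF linear_span_inc], simp only: bilinear_relations_def, blast)+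

lemma R_subset_kernel: "R \<subseteq> {p \<in> E. \<Theta> p = 0}"
proof (rule linear_span_minimal)
  have "pm.subspace {p \<in> E. \<Theta> p = 0}"
    using F.E_subspace
    by (auto simp: pm.subspace_def pure_tensor.ext_add lookup_add poly_mapping_eq_iff fun_eq_iff \<Theta>_scale)
  from F.submodule_image[OF this] show "submodule {p \<in> E. \<Theta> p = 0} complex_ring F" by auto
  have "pm.subspace E" by (rule F.E_subspace)
  note E_diff = pm.subspace_diff[OF this]
  show "bilinear_relations M N \<subseteq> {p \<in> E. \<Theta> p = 0}"
  proof -
    have 1: "single (u \<oplus>\<^bsub>M\<^esub> u', v) 1 - single (u, v) 1
        - single (u', v) 1 \<in> {p \<in> E. \<Theta> p = 0}"
      if "u \<in> carrier M" "u' \<in> carrier M" "v \<in> carrier N" for u u' v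
      using that
      by (intro CollectI conjI E_diff[unfolded mem_Collect_eq] poly_mapping_eqI)
        (auto simp: M.add_closed pure_tensor.ext_diff lookup_minus lookup_pure_tensor M.emb_add scale_right_distrib)
    have 2: "single (u, v \<oplus>\<^bsub>N\<^esub> v') 1 - single (u, v) 1
        - single (u, v') 1 \<in> {p \<in> E. \<Theta> p = 0}"
      if "u \<in> carrier M" "v \<in> carrier N" "v' \<in> carrier N" for u v v'
      using that
      by (intro CollectI conjI E_diff[unfolded mem_Collect_eq] poly_mapping_eqI)
        (auto simp: N.add_closed pure_tensor.ext_diff lookup_minus lookup_pure_tensor N.emb_add lookup_add
          scale_left_distrib)
    have 3: "single (c \<odot>\<^bsub>M\<^esub> u, v) 1 - single (u, v) c \<in> {p \<in> E. \<Theta> p = 0}"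
      if "u \<in> carrier M" "v \<in> carrier N" for c u v
      using that
      by (intro CollectI conjI E_diff[unfolded mem_Collect_eq] poly_mapping_eqI)
        (auto simp: M.smult_closed pure_tensor.ext_diff lookup_minus lookup_pure_tensor M.emb_smult ac_simps)
    have 4: "single (u, c \<odot>\<^bsub>N\<^esub> v) 1 - single (u, v) c \<in> {p \<in> E. \<Theta> p = 0}"
      if "u \<in> carrier M" "v \<in> carrier N" for c u v
      using that
      by (intro CollectI conjI E_diff[unfolded mem_Collect_eq] poly_mapping_eqI)
        (auto simp: N.smult_closed pure_tensor.ext_diff lookup_minus lookup_pure_tensor N.emb_smult)
    show ?thesis unfolding bilinear_relations_def using 1 2 3 4 by blast
  qed
qed

lemma zero_smult: "u \<in> carrier M \<Longrightarrow> 0 \<odot>\<^bsub>M\<^esub> u = \<zero>\<^bsub>M\<^esub>"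
  using M.emb_inj by (rule inj_onD) (simp_all add: M.emb_smult M.emb_zero M.smult_closed M.zero_closed)

lemma single_zero_left: "v \<in> carrier N \<Longrightarrow> single (\<zero>\<^bsub>M\<^esub>, v) 1 \<in> R"
  using relation_smult_left[of "\<zero>\<^bsub>M\<^esub>" v 0] by (simp add: zero_smult M.zero_closed)

definition e :: "int \<Rightarrow> 'v" where
  "e n = (SOME v. v \<in> carrier N \<and> \<beta> v = single n 1)"

lemma e: assumes "n \<in> J" shows "e n \<in> carrier N" "\<beta> (e n) = single n 1"
proof -
  have "\<exists>v. v \<in> carrier N \<and> \<beta> v = single n 1"
    using image assms by (metis (mono_tags, lifting) imageE insert_subset keys_single mem_Collect_eq
      empty_subsetI)
  from someI_ex[OF this] show "e n \<in> carrier N" "\<beta> (e n) = single n 1"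
    by (auto simp: e_def)
qed

text \<open>The bilinearity relations allow every tensor to be rewritten as a sum of \<open>u n \<otimes> e n\<close> with
  \<open>e n\<close> the basis of the second factor. The zeros of \<open>u\<close> outside the support let two normal forms be
  brought to a common support and added.\<close>

definition has_normal_form :: "(('u \<times> 'v) \<Rightarrow>\<^sub>0 complex) \<Rightarrow> bool" where
  "has_normal_form p \<longleftrightarrow> (\<exists>B u. finite B \<and> B \<subseteq> J \<and> (\<forall>n. u n \<in> carrier M) \<and> (\<forall>n. n \<notin> B \<longrightarrow> u n = \<zero>\<^bsub>M\<^esub>) \<and>
     p - (\<Sum>n\<in>B. single (u n, e n) 1) \<in> R)"

lemma has_normal_form_R: "p \<in> R \<Longrightarrow> has_normal_form p"
  unfolding has_normal_form_def by (rule exI[of _ "{}"], rule exI[of _ "\<lambda>_. \<zero>\<^bsub>M\<^esub>"]) (simp add: M.zero_closed)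

lemma has_normal_form_cong: "has_normal_form p \<Longrightarrow> q - p \<in> R \<Longrightarrow> has_normal_form q"
proof -
  assume "has_normal_form p" "q - p \<in> R"
  have eq: "q - S = (q - p) + (p - S)" for S by simp
  from \<open>has_normal_form p\<close> show "has_normal_form q"
    unfolding has_normal_form_def eq[of "sum _ _"] using R_add[OF \<open>q - p \<in> R\<close>] by blast
qed

lemma has_normal_form_add: assumes "has_normal_form p" "has_normal_form q" shows "has_normal_form (p + q)"
proof -
  let ?S = "\<lambda>B u. \<Sum>n\<in>B. single (u n, e n) (1::complex)"
  from assms(1) obtain B u where B: "finite B" "B \<subseteq> J" "\<forall>n. u n \<in> carrier M"
      "\<forall>n. n \<notin> B \<longrightarrow> u n = \<zero>\<^bsub>M\<^esub>" "p - ?S B u \<in> R"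
    unfolding has_normal_form_def by (elim exE conjE)
  from assms(2) obtain Y w where Y: "finite Y" "Y \<subseteq> J" "\<forall>n. w n \<in> carrier M"
      "\<forall>n. n \<notin> Y \<longrightarrow> w n = \<zero>\<^bsub>M\<^esub>" "q - ?S Y w \<in> R"
    unfolding has_normal_form_def by (elim exE conjE)
  have enlarge: "r - ?S (B \<union> Y) t \<in> R" if "r - ?S Z t \<in> R" "Z \<subseteq> B \<union> Y" "\<forall>n. n \<notin> Z \<longrightarrow> t n = \<zero>\<^bsub>M\<^esub>" for Z r t
  proof -
    have "?S (B \<union> Y) t = ?S Z t + ?S ((B \<union> Y) - Z) t"
      using B(1) Y(1) that(2) by (simp add: sum.subset_diff add.commute)
    moreover have "?S ((B \<union> Y) - Z) t \<in> R"
      by (rule R_sum) (use that B Y e single_zero_left in auto)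
    ultimately show ?thesis using R_diff[OF that(1)] by (simp flip: diff_diff_add)
  qed
  have "(p - ?S (B \<union> Y) u) + (q - ?S (B \<union> Y) w) - (\<Sum>n\<in>B \<union> Y.
      single (u n \<oplus>\<^bsub>M\<^esub> w n, e n) 1 - single (u n, e n) 1
        - single (w n, e n) 1) \<in> R"
    by (intro R_diff R_add R_sum enlarge[OF B(5)] enlarge[OF Y(5)] relation_add_left)
      (use B Y e in auto)
  then have "p + q - ?S (B \<union> Y) (\<lambda>n. u n \<oplus>\<^bsub>M\<^esub> w n) \<in> R"
    by (simp add: sum_subtractf sum.distrib algebra_simps)
  moreover have "\<zero>\<^bsub>M\<^esub> \<oplus>\<^bsub>M\<^esub> \<zero>\<^bsub>M\<^esub> = \<zero>\<^bsub>M\<^esub>"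
    using M.emb_inj by (rule inj_onD) (simp_all add: M.emb_add M.emb_zero M.add_closed M.zero_closed)
  ultimately show ?thesis unfolding has_normal_form_def using B Y
    by (intro exI[of _ "B \<union> Y"] exI[of _ "\<lambda>n. u n \<oplus>\<^bsub>M\<^esub> w n"]) (auto simp: M.add_closed)
qed

lemma has_normal_form_single: assumes u: "u \<in> carrier M" and v: "v \<in> carrier N"
  shows "has_normal_form (single (u, v) c)"
proof -
  have 1: "has_normal_form (single (u, v) 1)"
    if "u \<in> carrier M" "v \<in> carrier N" "\<beta> v = q" "keys q \<subseteq> J" for u v q
    using that(4,1-3)
  proof (induction q arbitrary: v rule: poly_mapping_keys_induct)
    case zero
    have "v = 0 \<odot>\<^bsub>N\<^esub> v"
      using N.emb_inj by (rule inj_onD) (use zero in \<open>simp_all add: N.emb_smult N.smult_closed\<close>)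
    with relation_smult_right[of u v 0] zero have "single (u, v) 1 \<in> R" by simp
    then show ?case by (rule has_normal_form_R)
  next
    case (single n d)
    have v: "v = d \<odot>\<^bsub>N\<^esub> e n"
      using N.emb_inj by (rule inj_onD) (use single e in \<open>simp_all add: N.emb_smult N.smult_closed\<close>)
    have "single (u, v) 1 - single (d \<odot>\<^bsub>M\<^esub> u, e n) 1 \<in> R"
      using R_diff[OF relation_smult_right[of u "e n" d] relation_smult_left[of u "e n" d]]
        single e by (simp add: v)
    moreover have "has_normal_form (single (d \<odot>\<^bsub>M\<^esub> u, e n) 1)"
      unfolding has_normal_form_def
      by (rule exI[of _ "{n}"], rule exI[of _ "\<lambda>i. if i = n then d \<odot>\<^bsub>M\<^esub> u else \<zero>\<^bsub>M\<^esub>"])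
        (use single in \<open>auto simp: M.zero_closed M.smult_closed R_zero\<close>)
    ultimately show ?case by (rule has_normal_form_cong[rotated])
  next
    case (add p q)
    have "p \<in> \<beta> ` carrier N" "q \<in> \<beta> ` carrier N" using add.hyps image by auto
    then obtain v1 v2 where v12: "v1 \<in> carrier N" "\<beta> v1 = p" "v2 \<in> carrier N" "\<beta> v2 = q"
      by (elim imageE) simp
    have v: "v = v1 \<oplus>\<^bsub>N\<^esub> v2"
      using N.emb_inj by (rule inj_onD) (use add.prems v12 in \<open>simp_all add: N.emb_add N.add_closed\<close>)
    have "has_normal_form (single (u, v1) 1 + single (u, v2) 1)"
      by (intro has_normal_form_add add.IH) (use v12 add.prems in auto)
    then show ?case
      by (rule has_normal_form_cong)
        (use relation_add_right[of u v1 v2] v12 add.prems in \<open>simp add: v algebra_simps\<close>)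
  qed
  have "keys (\<beta> v) \<subseteq> J" using image v by auto
  with 1[of "c \<odot>\<^bsub>M\<^esub> u" v] u v have "has_normal_form (single (c \<odot>\<^bsub>M\<^esub> u, v) 1)"
    by (simp add: M.smult_closed)
  then show ?thesis
    by (rule has_normal_form_cong) (use R_neg[OF relation_smult_left[OF u v, of c]] in simp)
qed

text \<open>The bilinearity relations generate the whole kernel of \<open>\<Theta>\<close>: on a normal form \<open>\<Theta>\<close> returns
  the coefficients \<open>u n\<close>, and hence detects whether they all vanish.\<close>

lemma kernel_eq: "R = {p \<in> E. \<Theta> p = 0}"
proof
  show "R \<subseteq> {p \<in> E. \<Theta> p = 0}" by (rule R_subset_kernel)
  show "{p \<in> E. \<Theta> p = 0} \<subseteq> R"
  proof clarify
    fix p assume p: "\<Theta> p = 0" and "keys p \<subseteq> carrier M \<times> carrier N"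
    from this(2) have "has_normal_form p"
      by (induction p rule: poly_mapping_keys_induct) (auto intro: has_normal_form_R R_zero has_normal_form_add has_normal_form_single)
    then obtain B u where B: "finite B" "B \<subseteq> J" "\<forall>n. u n \<in> carrier M"
      "p - (\<Sum>n\<in>B. single (u n, e n) 1) \<in> R" unfolding has_normal_form_def by (elim exE conjE)
    from B(4) R_subset_kernel p have "\<Theta> (\<Sum>n\<in>B. single (u n, e n) 1) = 0"
      by (auto simp: pure_tensor.ext_diff)
    then have 0: "(\<Sum>n\<in>B. lookup (pure_tensor (u n, e n) 1) k) = 0" for k
      by (simp add: pure_tensor.ext_sum flip: lookup_sum)
    have "u k = \<zero>\<^bsub>M\<^esub>" if "k \<in> B" for k
    proof -
      have "lookup (pure_tensor (u n, e n) 1) k = (if n = k then \<iota> (u n) else 0)" if "n \<in> B" for n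
        using B that e by (auto simp: lookup_pure_tensor lookup_single when_def subset_iff)
      with 0[of k] that B(1) have "\<iota> (u k) = 0" by simp
      then show ?thesis
        using M.emb_inj B(3) by (metis M.emb_zero M.zero_closed inj_onD)
    qed
    then have "(\<Sum>n\<in>B. single (u n, e n) 1) \<in> R"
      by (intro R_sum) (use B e single_zero_left in auto)
    from R_add[OF B(4) this] show "p \<in> R" by simp
  qed
qed

text \<open>The Leibniz rule: the generator acts inside each component through the first factor and
  moves components through the second one.\<close>

lemma \<Theta>_act: assumes "p \<in> E"
  shows "lookup (\<Theta> (act F g p)) n = A g (lookup (\<Theta> p) n) + s (\<kappa> g n) (lookup (\<Theta> p) (n - deg g))"
proof -
  have "keys p \<subseteq> carrier M \<times> carrier N" using assms by simp
  then show ?thesis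
  proof (induction p rule: poly_mapping_keys_induct)
    case (single x c)
    then show ?case
      by (auto simp: act_free leibniz_def pure_tensor.ext_add lookup_add lookup_pure_tensor act_M act_N A_linear ac_simps)
  qed (simp_all add: act_free A_zero leibniz.ext_add pure_tensor.ext_add lookup_add A_linear
      scale_right_distrib ac_simps)
qed

theorem embedding:
  obtains \<theta> where "vector_embedding (tensor_module M N) (\<lambda>c. Poly_Mapping.map (s c)) \<theta>"
    and "\<And>x g n. x \<in> carrier (tensor_module M N) \<Longrightarrow>
      lookup (\<theta> (act (tensor_module M N) g x)) n
        = A g (lookup (\<theta> x) n) + s (\<kappa> g n) (lookup (\<theta> x) (n - deg g))"
    and "\<And>x. x \<in> carrier (tensor_module M N) \<Longrightarrow> keys (\<theta> x) \<subseteq> J"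
    and "\<And>x n. x \<in> carrier (tensor_module M N) \<Longrightarrow> lookup (\<theta> x) n \<in> \<iota> ` carrier M"
proof -
  have R_act: "act F g p \<in> R" if "p \<in> R" for g p
  proof -
    have p: "p \<in> E" "\<Theta> p = 0" using that R_subset_kernel by auto
    then have "\<Theta> (act F g p) = 0"
      by (intro poly_mapping_eqI) (simp add: \<Theta>_act A_zero)
    with F.T_closed[OF p(1)] show ?thesis unfolding kernel_eq by blast
  qed
  note pq = F.presented_quotient[of R, folded tensor_module_def]
  interpret Q: linear_presentation "\<lambda>c::complex. Poly_Mapping.map ((*) c)" "tensor_module M N" E
      "\<lambda>x. R +>\<^bsub>F\<^esub> x" "act F"
    by (rule pq(1)) (use R_subset_kernel in \<open>auto simp: F_simps R_zero R_add R_scale R_act\<close>)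
  have coset_eq: "R +>\<^bsub>F\<^esub> x = R +>\<^bsub>F\<^esub> y \<longleftrightarrow> x - y \<in> R" if "x \<in> E" "y \<in> E" for x y
    by (rule pq(2)[OF _ _ _ _ _ that])
      (use R_subset_kernel in \<open>auto simp: F_simps R_zero R_add R_scale R_act\<close>)
  have ker: "\<Theta> x = 0 \<longleftrightarrow> R +>\<^bsub>F\<^esub> x = R +>\<^bsub>F\<^esub> 0" if "x \<in> E" for x
    using coset_eq[OF that F.E_zero] that kernel_eq by auto
  have scale: "\<Theta> (Poly_Mapping.map ((*) c) x) = Poly_Mapping.map (s c) (\<Theta> x)" for c x
    by (rule poly_mapping_eqI) (simp add: \<Theta>_scale map.rep_eq when_def)
  obtain \<theta> where th: "vector_embedding (tensor_module M N) (\<lambda>c. Poly_Mapping.map (s c)) \<theta>"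
      "\<And>x. x \<in> E \<Longrightarrow> \<theta> (R +>\<^bsub>F\<^esub> x) = \<Theta> x"
    using Q.embedding_of_linear_map[of \<Theta> "\<lambda>c. Poly_Mapping.map (s c)"] pure_tensor.ext_add scale ker by blast
  show ?thesis
  proof (rule that[OF th(1)])
    fix x assume "x \<in> carrier (tensor_module M N)"
    then obtain p where p: "p \<in> E" "x = R +>\<^bsub>F\<^esub> p" by (auto simp: Q.carrier_eq)
    show "lookup (\<theta> (act (tensor_module M N) g x)) n
        = A g (lookup (\<theta> x) n) + s (\<kappa> g n) (lookup (\<theta> x) (n - deg g))" for g n
      by (simp only: p(2) Q.act_eq[OF p(1)] th(2)[OF p(1)] th(2)[OF F.T_closed[OF p(1)]] \<Theta>_act[OF p(1)])
    have "keys p \<subseteq> carrier M \<times> carrier N" using p(1) by simp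
    then have *: "keys (\<Theta> p) \<subseteq> J \<and> (\<forall>n. lookup (\<Theta> p) n \<in> \<iota> ` carrier M)"
    proof (induction p rule: poly_mapping_keys_induct)
      case zero
      show ?case using M.zero_closed M.emb_zero by (auto simp: image_iff)
    next
      case (single x c)
      then have u: "fst x \<in> carrier M" "snd x \<in> carrier N" by auto
      have "keys (pure_tensor x c) \<subseteq> keys (\<beta> (snd x))" by (auto simp: in_keys_iff lookup_pure_tensor)
      moreover have "keys (\<beta> (snd x)) \<subseteq> J" using image u(2) by auto
      moreover have "lookup (pure_tensor x c) n \<in> \<iota> ` carrier M" for n
        unfolding lookup_pure_tensor M.emb_smult[OF u(1), symmetric] using M.smult_closed[OF u(1)] by blast
      ultimately show ?case by simp
    next
      case (add p q)
      have "lookup (\<Theta> p) n + lookup (\<Theta> q) n \<in> \<iota> ` carrier M" for n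
      proof -
        from add.IH have "lookup (\<Theta> p) n \<in> \<iota> ` carrier M" "lookup (\<Theta> q) n \<in> \<iota> ` carrier M" by auto
        then obtain u w where "u \<in> carrier M" "w \<in> carrier M" "lookup (\<Theta> p) n = \<iota> u"
          "lookup (\<Theta> q) n = \<iota> w" by (elim imageE)
        then show ?thesis using M.add_closed[of u w] M.emb_add[of u w] by (metis imageI)
      qed
      moreover have "keys (\<Theta> p + \<Theta> q) \<subseteq> J"
        using order_trans[OF keys_add Un_least] add.IH by blast
      ultimately show ?case by (simp only: pure_tensor.ext_add lookup_add) blast
    qed
    show "keys (\<theta> x) \<subseteq> J" and "lookup (\<theta> x) n \<in> \<iota> ` carrier M" for n
      using * th(2)[OF p(1)] p(2) by auto
  qed
qed

end

section \<open>Simple highest weight modules\<close>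

text \<open>Choosing a complement of \<open>K\<close> realises the quotient by \<open>K\<close> as the range of a linear
  projection.\<close>

lemma (in vector_space) subspace_projection:
  assumes K: "subspace K"
  obtains P where "\<And>x y. P (x + y) = P x + P y" "\<And>c x. P (scale c x) = scale c (P x)"
    "\<And>x. P x = 0 \<longleftrightarrow> x \<in> K" "\<And>x. x - P x \<in> K"
proof -
  obtain B where B: "B \<subseteq> K" "independent B" "K \<subseteq> span B"
    using maximal_independent_subset[of K] by blast
  interpret vp: vector_space_pair scale scale ..
  let ?B = "extend_basis B"
  define P where "P = vp.construct ?B (\<lambda>b. if b \<in> B then 0 else b)"
  note indep = independent_extend_basis[OF B(2)]
  interpret P: Vector_Spaces.linear scale scale P unfolding P_def by (rule vp.linear_construct[OF indep])
  have sub: "B \<subseteq> ?B" by (rule extend_basis_superset[OF B(2)])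
  have PB: "P b = (if b \<in> B then 0 else b)" if "b \<in> ?B" for b
    unfolding P_def by (rule vp.construct_basis[OF indep that])
  have "subspace {x. x - P x \<in> K}"
  proof (rule subspaceI)
    fix x y assume "x \<in> {x. x - P x \<in> K}" "y \<in> {x. x - P x \<in> K}"
    then have "(x - P x) + (y - P y) \<in> K" using subspace_add[OF K] by blast
    then show "x + y \<in> {x. x - P x \<in> K}" by (simp add: P.add algebra_simps)
  next
    fix c x assume "x \<in> {x. x - P x \<in> K}"
    then have "scale c (x - P x) \<in> K" using subspace_scale[OF K] by blast
    then show "scale c x \<in> {x. x - P x \<in> K}" by (simp add: P.scale scale_right_diff_distrib)
  qed (simp add: subspace_0[OF K])
  moreover have "?B \<subseteq> {x. x - P x \<in> K}"
    using B(1) subspace_0[OF K] by (auto simp: PB)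
  ultimately have "span ?B \<subseteq> {x. x - P x \<in> K}" by (rule span_minimal[rotated])
  then have diff: "x - P x \<in> K" for x using span_extend_basis[OF B(2)] by auto
  have P0: "P x = 0" if "x \<in> K" for x
  proof -
    have "B \<subseteq> {x. P x = 0}" using sub PB by auto
    moreover have "subspace {x. P x = 0}" by (rule P.subspace_kernel)
    ultimately have "span B \<subseteq> {x. P x = 0}" by (rule span_minimal)
    with B(3) that show ?thesis by auto
  qed
  show ?thesis
    by (rule that[of P]) (use diff P0 in \<open>auto simp: P.add P.scale\<close>, metis diff diff_zero)
qed

lemma ring_ring_of_type_algebra: "ring (ring_of_type_algebra :: 'a::ring_1 ring)"
proof -
  have "\<exists>y. x + y = 0" for x :: 'a
    using add.right_inverse by blast
  then show ?thesis
    unfolding ring_of_type_algebra_def using add.right_inverse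
    by unfold_locales (auto simp: algebra_simps Units_def)
qed

lemma scalar_simps [simp]: "scalar 0 = 0" "scalar 1 = 1"
  by (simp_all add: scalar_def)

lemma scalar_add: "scalar (c + d) = scalar c + scalar d"
  by (simp add: scalar_def single_add)

lemma scalar_mult: "scalar (c * d) = scalar c * scalar d"
  by (simp add: scalar_def mult_single)

text \<open>The empty word is the unit for concatenation, hence scalars are central.\<close>

lemma scalar_commutes: "p * scalar c = scalar c * p"
proof -
  have "keys p \<subseteq> UNIV" by simp
  then show ?thesis
    by (induction p rule: poly_mapping_keys_induct) (simp_all add: scalar_def mult_single algebra_simps)
qed

lemma scalar_left_commute: "p * (scalar c * q) = scalar c * (p * q)"
  by (metis mult.assoc scalar_commutes)

interpretation free: vector_space "\<lambda>c (q :: 'g free_algebra). scalar c * q"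
  by unfold_locales (simp_all add: algebra_simps scalar_add scalar_mult)

lemma gen_times_single: "gen g * single (Word w) c = single (Word (g # w)) c"
  by (simp add: gen_def mult_single plus_word_def)

lemma commutator_ideal: "ideal commutator_ideal (ring_of_type_algebra :: vir free_algebra ring)"
  unfolding commutator_ideal_def by (rule ring.genideal_ideal[OF ring_ring_of_type_algebra]) simp

lemma commutator_in_ideal:
  "gen x * gen y - gen y * gen x
     - additive_ext (\<lambda>g c. scalar c * gen g) (vir_bracket x y) \<in> commutator_ideal"
  unfolding commutator_ideal_def additive_ext_def
  by (rule subsetD[OF ring.genideal_self[OF ring_ring_of_type_algebra]]) auto

lemma env_class_hom:
  "env_class p \<oplus>\<^bsub>enveloping_ring\<^esub> env_class q = env_class (p + q)"
  "env_class p \<otimes>\<^bsub>enveloping_ring\<^esub> env_class q = env_class (p * q)"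
  using ring_hom_add[OF ideal.rcos_ring_hom[OF commutator_ideal], of p q] ring_hom_mult[OF ideal.rcos_ring_hom[OF commutator_ideal], of p q]
  by (simp_all add: env_class_def enveloping_ring_def)

lemma carrier_enveloping: "carrier enveloping_ring = range env_class"
  by (auto simp: enveloping_ring_def FactRing_def A_RCOSETS_def' env_class_def)

lemma abelian_subgroup_commutator:
  "abelian_subgroup commutator_ideal (ring_of_type_algebra :: vir free_algebra ring)"
  using commutator_ideal by (meson abelian_subgroupI3 ideal.axioms(1,2) ring.axioms(1))

lemma env_class_zero: "q \<in> commutator_ideal \<Longrightarrow> env_class q = \<zero>\<^bsub>enveloping_ring\<^esub>"
  using abelian_subgroup.a_rcos_const[OF abelian_subgroup_commutator] by (simp add: enveloping_ring_def FactRing_def env_class_def)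

interpretation enveloping: linear_presentation "\<lambda>c q. scalar c * q" enveloping_module UNIV env_class
    "\<lambda>g q. gen g * q"
proof unfold_locales
  show "\<zero>\<^bsub>enveloping_module\<^esub> = env_class 0"
    using env_class_zero[of 0] additive_subgroup.zero_closed[OF ideal.axioms(1)[OF commutator_ideal]] by (simp add: enveloping_module_def)
qed (simp_all add: enveloping_module_def carrier_enveloping env_class_hom algebra_simps)

lemma verma_ideal_closed:
  shows "verma_ideal c h \<subseteq> carrier enveloping_ring"
    and "\<zero>\<^bsub>enveloping_ring\<^esub> \<in> verma_ideal c h"
    and "x \<in> verma_ideal c h \<Longrightarrow> y \<in> verma_ideal c h \<Longrightarrow> x \<oplus>\<^bsub>enveloping_ring\<^esub> y \<in> verma_ideal c h"
    and "x \<in> verma_ideal c h \<Longrightarrow> env_class r \<otimes>\<^bsub>enveloping_ring\<^esub> x \<in> verma_ideal c h"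
    and "i > 0 \<Longrightarrow> env_class (gen (D i)) \<in> verma_ideal c h"
proof -
  interpret ring enveloping_ring unfolding enveloping_ring_def by (rule ideal.quotient_is_ring[OF commutator_ideal])
  have "additive_subgroup (carrier enveloping_ring) enveloping_ring"
    by (rule additive_subgroup.intro) (rule add.subgroup_self)
  then have "left_ideal enveloping_ring (carrier enveloping_ring)"
    by (simp add: left_ideal_def)
  then show "verma_ideal c h \<subseteq> carrier enveloping_ring"
    unfolding verma_ideal_def by (rule hull_minimal[rotated]) (auto simp: carrier_enveloping)
  show "\<zero>\<^bsub>enveloping_ring\<^esub> \<in> verma_ideal c h"
    unfolding verma_ideal_def hull_def left_ideal_def by (auto dest: additive_subgroup.zero_closed)
  show "x \<in> verma_ideal c h \<Longrightarrow> y \<in> verma_ideal c h \<Longrightarrow> x \<oplus>\<^bsub>enveloping_ring\<^esub> y \<in> verma_ideal c h"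
    unfolding verma_ideal_def hull_def left_ideal_def by (auto dest: additive_subgroup.a_closed)
  show "x \<in> verma_ideal c h \<Longrightarrow> env_class r \<otimes>\<^bsub>enveloping_ring\<^esub> x \<in> verma_ideal c h"
    unfolding verma_ideal_def hull_def left_ideal_def by (auto simp: carrier_enveloping)
  show "i > 0 \<Longrightarrow> env_class (gen (D i)) \<in> verma_ideal c h"
    unfolding verma_ideal_def by (rule hull_inc) blast
qed

text \<open>The preimage \<open>K\<close> in the free algebra of the submodule by which one divides: the simple
  highest weight module is the free algebra modulo \<open>K\<close>, and simplicity is the maximality of \<open>K\<close>.\<close>

locale highest_weight_kernel =
  fixes K :: "vir free_algebra set"
  assumes K_subspace: "free.subspace K"
    and K_gen: "q \<in> K \<Longrightarrow> gen g * q \<in> K"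
    and K_comm: "(gen x * gen y - gen y * gen x
      - additive_ext (\<lambda>g c. scalar c * gen g) (vir_bracket x y)) * q \<in> K"
    and K_pos: "i > 0 \<Longrightarrow> q * gen (D i) \<in> K"
    and K_max: "free.subspace S \<Longrightarrow> (\<And>g q. q \<in> S \<Longrightarrow> gen g * q \<in> S) \<Longrightarrow> K \<subseteq> S \<Longrightarrow>
      S = K \<or> S = UNIV"
begin

lemmas K_add = free.subspace_add[OF K_subspace] and K_diff = free.subspace_diff[OF K_subspace]
  and K_scale = free.subspace_scale[OF K_subspace] and K_zero = free.subspace_0[OF K_subspace]

lemma K_scaleD: "scalar c * q \<in> K \<Longrightarrow> c \<noteq> 0 \<Longrightarrow> q \<in> K"
  using K_scale[of "scalar c * q" "inverse c"] by (simp flip: mult.assoc scalar_mult)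

interpretation br: additive_family "\<lambda>(g :: vir) c. scalar c * gen g"
  by unfold_locales (simp add: scalar_add algebra_simps)

lemma K_comm_D:
  "gen (D k) * (gen (D m) * q) - gen (D m) * (gen (D k) * q)
    - (scalar (of_int (m - k)) * (gen (D (m + k)) * q)
       + (if k = - m then scalar (of_int (k ^ 3 - k) / 12) * (gen Z * q) else 0)) \<in> K"
proof -
  have "additive_ext (\<lambda>g c. scalar c * gen g) (vir_bracket (D k) (D m))
    = scalar (of_int (m - k)) * gen (D (m + k))
       + (if k = - m then scalar (of_int (k ^ 3 - k) / 12) * gen Z else 0)"
    unfolding vir_bracket.simps br.ext_add by (simp del: of_int_diff)
  with K_comm[of "D k" "D m" q] show ?thesis
    by (simp add: algebra_simps split: if_splits)
qed

lemma K_comm_Z: "gen x * (gen Z * q) - gen Z * (gen x * q) \<in> K"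
proof -
  have "vir_bracket x Z = 0" by (cases x) auto
  with K_comm[of x Z q] show ?thesis by (simp add: algebra_simps)
qed

text \<open>Raising operators kill the highest weight vector, and commuting \<open>D k\<close> past a letter \<open>D m\<close>
  produces \<open>D (m + k)\<close>, which is again a raising operator of large index. The bound avoids
  \<open>k = - m\<close>, where the central term would appear.\<close>

lemma locally_nilpotent: "\<exists>N. \<forall>k\<ge>N. gen (D k) * q \<in> K"
proof -
  have word: "\<exists>N. \<forall>k\<ge>N. gen (D k) * single (Word w) c \<in> K" for w c
  proof (induction w)
    case Nil
    have "gen (D k) * single (Word []) c \<in> K" if "k \<ge> 1" for k
      using K_scale[OF K_pos[of k 1], of c] that scalar_commutes[of "gen (D k)" c]
      by (simp add: scalar_def zero_word_def)
    then show ?case by blast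
  next
    case (Cons g w)
    let ?q = "single (Word w) c"
    obtain N where N: "\<And>k. k \<ge> N \<Longrightarrow> gen (D k) * ?q \<in> K" using Cons.IH by blast
    have "\<exists>N. \<forall>k\<ge>N. gen (D k) * (gen g * ?q) \<in> K"
    proof (cases g)
      case (D m)
      have "gen (D k) * (gen (D m) * ?q) \<in> K" if "k \<ge> max N (max (N - m) (1 - m))" for k
      proof -
        have "scalar (of_int (m - k)) * (gen (D (m + k)) * ?q) \<in> K"
          by (rule K_scale[OF N]) (use that in simp)
        from K_add[OF K_add[OF K_comm_D[of k m ?q] this] K_gen[OF N[of k], of "D m"]] that
        show ?thesis by (simp split: if_splits)
      qed
      then show ?thesis unfolding D by blast
    next
      case Z
      have "gen (D k) * (gen Z * ?q) \<in> K" if "k \<ge> N" for k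
        using K_add[OF K_comm_Z[of "D k" ?q] K_gen[OF N[OF that], of Z]] by simp
      then show ?thesis unfolding Z by blast
    qed
    then show ?case by (simp add: gen_times_single)
  qed
  have "keys q \<subseteq> UNIV" by simp
  then show ?thesis
  proof (induction q rule: poly_mapping_keys_induct)
    case zero
    show ?case using K_zero by simp
  next
    case (single x c)
    show ?case using word[of "letters x" c] by simp
  next
    case (add p q)
    then obtain N N' where "\<And>k. k \<ge> N \<Longrightarrow> gen (D k) * p \<in> K" "\<And>k. k \<ge> N' \<Longrightarrow> gen (D k) * q \<in> K" by blast
    then have "gen (D k) * (p + q) \<in> K" if "k \<ge> max N N'" for k
      using that by (simp add: distrib_left K_add)
    then show ?case by blast
  qed
qed

text \<open>If arbitrarily low operators \<open>D (- m)\<close> kill a vector \<open>q\<close>, bracket them with the raising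
  operators \<open>D (j + m)\<close>, which kill it as well: every \<open>D j\<close> with \<open>j \<noteq> 0\<close> kills it. The brackets of
  \<open>D k\<close> with \<open>D (- k)\<close> for \<open>k = 1\<close> and \<open>k = 2\<close> are independent combinations of \<open>D 0\<close> and \<open>Z\<close>, so
  these kill \<open>q\<close> too. Thus \<open>q\<close> spans a submodule, which by simplicity is everything.\<close>

lemma lowering_dichotomy:
  assumes q: "q \<notin> K" and inf: "\<And>N. \<exists>m\<ge>N. gen (D (- m)) * q \<in> K"
  shows "gen g * x \<in> K" and "\<exists>c. x - scalar c * q \<in> K"
proof -
  obtain N where N: "\<And>k. k \<ge> N \<Longrightarrow> gen (D k) * q \<in> K" using locally_nilpotent by blast
  have nonzero: "gen (D j) * q \<in> K" if "j \<noteq> 0" for j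
  proof -
    \<comment> \<open>so large that \<open>j + m \<ge> N\<close> and the coefficient \<open>- 2 m - j\<close> of the bracket is not 0\<close>
    obtain m where m: "m \<ge> max (N - j) (1 + \<bar>j\<bar>)" "gen (D (- m)) * q \<in> K" using inf by blast
    have k: "gen (D (j + m)) * q \<in> K" by (rule N) (use m in simp)
    have "scalar (of_int (- m - (j + m))) * (gen (D j) * q) \<in> K"
      using K_diff[OF K_diff[OF K_gen[OF m(2), of "D (j + m)"] K_gen[OF k, of "D (- m)"]]
          K_comm_D[of "j + m" "- m" q]] that by simp
    then show ?thesis by (rule K_scaleD) (use m in \<open>unfold of_int_eq_0_iff, linarith\<close>)
  qed
  have comm: "scalar (of_int (- k - k)) * (gen (D 0) * q) + scalar (of_int (k ^ 3 - k) / 12) * (gen Z * q) \<in> K"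
    if "k \<noteq> 0" for k
    using K_diff[OF K_diff[OF K_gen[OF nonzero[of "- k"], of "D k"] K_gen[OF nonzero[of k], of "D (- k)"]]
          K_comm_D[of k "- k" q]] that by simp
  have D0: "gen (D 0) * q \<in> K"
    using comm[of 1] K_scaleD[of "-2" "gen (D 0) * q"] by simp
  \<comment> \<open>the central coefficient \<open>(2 ^ 3 - 2) / 12\<close>\<close>
  have "scalar (1/2) * (gen Z * q) \<in> K"
    using K_diff[OF comm[of 2] K_scale[OF D0, of "-4"]] by simp
  then have "gen Z * q \<in> K" by (rule K_scaleD) simp
  then have all: "gen g * q \<in> K" for g
  proof (cases g)
    case (D j)
    show ?thesis unfolding D by (cases "j = 0") (simp_all only: D0 nonzero not_False_eq_True)
  qed (simp only:)
  define S where "S = {x. \<exists>c. x - scalar c * q \<in> K}"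
  have SI: "x \<in> S" if "x - scalar c * q \<in> K" for x c using that by (auto simp: S_def)
  have gen_S: "gen g * x \<in> K" if x: "x \<in> S" for g x
  proof -
    from x obtain c where "x - scalar c * q \<in> K" by (auto simp: S_def)
    from K_add[OF K_gen[OF this, of g] K_scale[OF all[of g], of c]] show ?thesis
      by (simp add: right_diff_distrib scalar_left_commute)
  qed
  have "free.subspace S"
  proof (rule free.subspaceI)
    show "0 \<in> S" by (rule SI[of _ 0]) (simp add: K_zero)
    fix x y d assume "x \<in> S" then obtain c where c: "x - scalar c * q \<in> K" by (auto simp: S_def)
    show "scalar d * x \<in> S"
      by (rule SI[of _ "d * c"]) (use K_scale[OF c, of d] in \<open>simp add: right_diff_distrib\<close>)
    assume "y \<in> S" then obtain c' where c': "y - scalar c' * q \<in> K" by (auto simp: S_def)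
    show "x + y \<in> S"
      by (rule SI[of _ "c + c'"]) (use K_add[OF c c'] in \<open>simp add: scalar_add algebra_simps\<close>)
  qed
  moreover have KS: "K \<subseteq> S" using SI[of _ 0] by auto
  moreover have "gen g * x \<in> S" if "x \<in> S" for g x using gen_S[OF that] KS by blast
  ultimately have "S = K \<or> S = UNIV" by (intro K_max)
  moreover have "q \<in> S" by (rule SI[of _ 1]) (simp add: K_zero)
  ultimately have S: "S = UNIV" using q by blast
  show "gen g * x \<in> K" using gen_S S by blast
  show "\<exists>c. x - scalar c * q \<in> K" using S by (auto simp: S_def)
qed

end

text \<open>The last conclusion is the dichotomy that drives the proof: either every nonzero vector
  survives all sufficiently low operators \<open>D (- m)\<close>, or the module is trivial and one-dimensional.\<close>

theorem simple_highest_weight_module_embedding: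
  assumes J: "maximal_submodule virasoro (verma c h) J" and V: "V = quotient_module (verma c h) J"
  obtains \<iota> :: "_ \<Rightarrow> vir free_algebra" and A
  where "vector_embedding V (\<lambda>c q. scalar c * q) \<iota>"
    and "\<And>g x y. A g (x + y) = A g x + A g y" and "\<And>g c x. A g (scalar c * x) = scalar c * A g x"
    and "\<And>g u. u \<in> carrier V \<Longrightarrow> \<iota> (act V g u) = A g (\<iota> u)"
    and "\<And>x. x \<in> \<iota> ` carrier V \<Longrightarrow> \<exists>N. \<forall>k\<ge>N. A (D k) x = 0"
    and "(\<forall>x\<in>\<iota> ` carrier V. x \<noteq> 0 \<longrightarrow> (\<exists>N. \<forall>m\<ge>N. A (D (- m)) x \<noteq> 0)) \<or>
         (\<forall>x\<in>\<iota> ` carrier V. A (D 0) x = 0) \<and> (\<exists>x0. \<forall>x\<in>\<iota> ` carrier V. \<exists>c. x = scalar c * x0)"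
proof -
  let ?VI = "verma_ideal c h"
  define \<pi> where "\<pi> q = ?VI +>\<^bsub>enveloping_module\<^esub> env_class q" for q
  have env_simps: "\<zero>\<^bsub>enveloping_module\<^esub> = \<zero>\<^bsub>enveloping_ring\<^esub>"
    "carrier enveloping_module = carrier enveloping_ring"
    "x \<oplus>\<^bsub>enveloping_module\<^esub> y = x \<oplus>\<^bsub>enveloping_ring\<^esub> y"
    "d \<odot>\<^bsub>enveloping_module\<^esub> x = env_class (scalar d) \<otimes>\<^bsub>enveloping_ring\<^esub> x"
    "act enveloping_module g x = env_class (gen g) \<otimes>\<^bsub>enveloping_ring\<^esub> x" for x y d g
    by (simp_all add: enveloping_module_def)
  note vq = enveloping.presented_quotient[of ?VI, folded verma_def \<pi>_def]
  interpret verma: linear_presentation "\<lambda>c q. scalar c * q" "verma c h" UNIV \<pi> "\<lambda>g q. gen g * q"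
    by (rule vq(1)) (simp_all add: env_simps verma_ideal_closed)
  have \<pi>_eq: "\<pi> x = \<pi> y \<longleftrightarrow> env_class (x - y) \<in> ?VI" for x y
    by (rule vq(2)) (simp_all add: env_simps verma_ideal_closed)
  have Jsub: "submodule J complex_ring (verma c h)" and Jact: "\<And>g v. v \<in> J \<Longrightarrow> act (verma c h) g v \<in> J"
    and Jmax: "\<And>S. lie_submodule virasoro (verma c h) S \<Longrightarrow> J \<subseteq> S \<Longrightarrow> S = J \<or> S = carrier (verma c h)"
    using J by (auto simp: maximal_submodule_def lie_submodule_def virasoro_def)
  note Jc = submodule_closed[OF Jsub]
  define \<rho> where "\<rho> q = J +>\<^bsub>verma c h\<^esub> \<pi> q" for q
  note jq = verma.presented_quotient[of J, folded V \<rho>_def]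
  interpret V: linear_presentation "\<lambda>c q. scalar c * q" V UNIV \<rho> "\<lambda>g q. gen g * q"
    by (rule jq(1)) (use Jc Jact in auto)
  define K where "K = {q. \<pi> q \<in> J}"
  have \<rho>_eq: "\<rho> x = \<rho> y \<longleftrightarrow> x - y \<in> K" for x y
    unfolding K_def mem_Collect_eq by (rule jq(2)) (use Jc Jact in auto)
  have \<pi>J: "\<pi> q \<in> J" if "env_class q \<in> ?VI" for q
    using that \<pi>_eq[of q 0] Jc(2) by (simp add: verma.zero_eq)
  interpret highest_weight_kernel K
  proof
    show "free.subspace K"
      unfolding K_def by (rule free.subspaceI)
        (use Jc in \<open>auto simp flip: verma.zero_eq verma.add_eq verma.smult_eq\<close>)
    show "gen g * q \<in> K" if "q \<in> K" for g q
      using that Jact by (simp add: K_def flip: verma.act_eq)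
    show "q * gen (D i) \<in> K" if "i > 0" for q and i :: int
      unfolding K_def mem_Collect_eq using verma_ideal_closed(4)[OF verma_ideal_closed(5)[OF that], of q c h]
      by (intro \<pi>J) (simp add: env_class_hom)
    show "(gen x * gen y - gen y * gen x
      - additive_ext (\<lambda>g c. scalar c * gen g) (vir_bracket x y)) * q \<in> K" for x y q
      unfolding K_def mem_Collect_eq
      using env_class_zero[OF ideal.I_r_closed[OF commutator_ideal commutator_in_ideal, of q x y]] verma_ideal_closed(2)
      by (intro \<pi>J) simp
    fix S assume S: "free.subspace S" "\<And>g q. q \<in> S \<Longrightarrow> gen g * q \<in> S" "K \<subseteq> S"
    have "lie_submodule virasoro (verma c h) (\<pi> ` S)"
      unfolding lie_submodule_def using verma.submodule_image[OF S(1)] S(2)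
      by (auto simp: verma.act_eq)
    moreover have "J \<subseteq> \<pi> ` S"
      using Jc(1) S(3) by (force simp: verma.carrier_eq K_def)
    ultimately consider "\<pi> ` S = J" | "\<pi> ` S = carrier (verma c h)" using Jmax by blast
    then show "S = K \<or> S = UNIV"
    proof cases
      case 1
      then show ?thesis using S(3) by (auto simp: K_def)
    next
      case 2
      have "x \<in> S" for x
      proof -
        have "\<pi> x \<in> \<pi> ` S" using 2 by (simp add: verma.carrier_eq)
        then obtain y where y: "y \<in> S" "\<pi> x = \<pi> y" by auto
        then have "x - y \<in> K" using \<pi>J \<pi>_eq by (simp add: K_def)
        then show ?thesis using free.subspace_add[OF S(1), of "x - y" y] S(3) y(1) by auto
      qed
      then show ?thesis by auto
    qed
  qed
  obtain P where P: "\<And>x y. P (x + y) = P x + P y" "\<And>c x. P (scalar c * x) = scalar c * P x"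
    "\<And>x. P x = 0 \<longleftrightarrow> x \<in> K" "\<And>x. x - P x \<in> K"
    using free.subspace_projection[OF K_subspace] by blast
  obtain \<iota> where emb: "vector_embedding V (\<lambda>c q. scalar c * q) \<iota>" and \<iota>: "\<And>q. \<iota> (\<rho> q) = P q"
    using V.embedding_of_linear_map[of P "\<lambda>c q. scalar c * q"] P(1-3) \<rho>_eq by auto
  have P_eq: "P x = P y" if "x - y \<in> K" for x y
    using P(1)[of "x - y" y] P(3)[of "x - y"] that by simp
  have range: "\<iota> ` carrier V = range P" by (simp add: V.carrier_eq image_image \<iota>)
  have P_notin: "x \<notin> K \<Longrightarrow> P x \<notin> K" for x using K_add[OF P(4)[of x]] by fastforce
  have dich: "(\<forall>x\<in>range P. x \<noteq> 0 \<longrightarrow> (\<exists>N. \<forall>m\<ge>N. P (gen (D (- m)) * x) \<noteq> 0)) \<or>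
         (\<forall>x\<in>range P. P (gen (D 0) * x) = 0) \<and> (\<exists>x0. \<forall>x\<in>range P. \<exists>c. x = scalar c * x0)"
  proof (rule disjCI)
    assume neg: "\<not> ((\<forall>x\<in>range P. P (gen (D 0) * x) = 0) \<and> (\<exists>x0. \<forall>x\<in>range P. \<exists>c. x = scalar c * x0))"
    show "\<forall>x\<in>range P. x \<noteq> 0 \<longrightarrow> (\<exists>N. \<forall>m\<ge>N. P (gen (D (- m)) * x) \<noteq> 0)"
    proof (rule ccontr)
      assume "\<not> (\<forall>x\<in>range P. x \<noteq> 0 \<longrightarrow> (\<exists>N. \<forall>m\<ge>N. P (gen (D (- m)) * x) \<noteq> 0))"
      then obtain q where q: "P q \<noteq> 0" "\<And>N. \<exists>m\<ge>N. P (gen (D (- m)) * P q) = 0" by auto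
      have "P q \<notin> K" using q(1) P(3) P_notin by auto
      note ld = lowering_dichotomy[OF this, folded P(3), OF q(2)]
      have "\<exists>c. P x = scalar c * P (P q)" for x
      proof -
        obtain c where "P (x - scalar c * P q) = 0" using ld(2) by blast
        then have "P x = P (scalar c * P q)" by (intro P_eq) (simp add: P(3))
        then show ?thesis by (auto simp: P(2))
      qed
      then have "\<exists>x0. \<forall>x\<in>range P. \<exists>c. x = scalar c * x0" by blast
      moreover have "\<forall>x\<in>range P. P (gen (D 0) * x) = 0" using ld(1) by blast
      ultimately show False using neg by blast
    qed
  qed
  show ?thesis
  proof (rule that[of \<iota> "\<lambda>g x. P (gen g * x)"])
    show "\<iota> (act V g u) = P (gen g * \<iota> u)" if "u \<in> carrier V" for g u
    proof -
      from that obtain q where q: "u = \<rho> q" by (auto simp: V.carrier_eq)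
      have "gen g * q - gen g * P q \<in> K"
        using K_gen[OF P(4)[of q], of g] by (simp add: right_diff_distrib)
      then show ?thesis by (simp add: q V.act_eq \<iota> P_eq)
    qed
    show "\<exists>N. \<forall>k\<ge>N. P (gen (D k) * x) = 0" for x
      using locally_nilpotent[of x] by (simp add: P(3))
  qed (use emb dich in \<open>simp_all add: P(1,2) distrib_left scalar_left_commute range\<close>)
qed

section \<open>The intermediate series\<close>

fun degree :: "vir \<Rightarrow> int" where
  "degree (D m) = m"
| "degree Z = 0"

text \<open>The weights of the simple subquotient: when \<open>b\<close> is 0 or 1 and \<open>a\<close> is an integer, the basis
  vector with index \<open>- a\<close> is divided out or left out.\<close>

definition indices :: "complex \<Rightarrow> complex \<Rightarrow> int set" where
  "indices a b = {n. \<not> (of_int n = - a \<and> (b = 0 \<or> b = 1))}"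

fun shift_coeff :: "complex \<Rightarrow> complex \<Rightarrow> vir \<Rightarrow> int \<Rightarrow> complex" where
  "shift_coeff a b (D m) n = (if n \<in> indices a b then a + of_int (n - m) + b * of_int m else 0)"
| "shift_coeff a b Z n = 0"

lemma lookup_act_intermediate:
  "lookup (act (intermediate_module a b) (D m) p) n
     = (a + of_int (n - m) + b * of_int m) * lookup p (n - m)"
proof -
  have "lookup (act (intermediate_module a b) (D m) p) n
      = (\<Sum>i\<in>keys p. lookup (single (i + m) ((a + of_int i + b * of_int m) * lookup p i)) n)"
    unfolding intermediate_module_def by (simp only: rep.simps vir.case lookup_sum)
  also have "\<dots> = (\<Sum>i\<in>keys p. if i = n - m then (a + of_int i + b * of_int m) * lookup p i else 0)"
    by (intro sum.cong) (auto simp: lookup_single when_def)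
  also have "\<dots> = (a + of_int (n - m) + b * of_int m) * lookup p (n - m)"
    by (subst sum.delta[OF finite_keys]) (simp add: in_keys_iff)
  finally show ?thesis .
qed

lemma act_intermediate_Z: "act (intermediate_module a b) Z p = 0"
  by (simp add: intermediate_module_def)

text \<open>Both exceptional cases and the generic one are subquotients spanned by basis vectors: the
  submodule with indices in \<open>S\<close> modulo the one with indices in \<open>S - J\<close>. Deleting the coefficients
  outside \<open>J\<close> identifies it with the functions supported in \<open>J\<close>.\<close>

lemma subquotient_embedding:
  fixes a b :: complex and S :: "int set"
  defines "J \<equiv> indices a b"
  defines "A \<equiv> intermediate_module a b\<lparr>carrier := {p. keys p \<subseteq> S}\<rparr>"
  defines "Q \<equiv> quotient_module A {p. keys p \<subseteq> S - J}"
  assumes JS: "J \<subseteq> S"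
    and stays: "\<And>n m. n \<in> S \<Longrightarrow> n + m \<notin> S \<Longrightarrow> a + of_int n + b * of_int m = 0"
    and dies: "\<And>n m. n \<in> S - J \<Longrightarrow> n + m \<in> J \<Longrightarrow> a + of_int n + b * of_int m = 0"
  obtains \<beta> where "vector_embedding Q (\<lambda>c. Poly_Mapping.map ((*) c)) \<beta>"
    and "\<beta> ` carrier Q = {q. keys q \<subseteq> J}"
    and "\<And>g v n. v \<in> carrier Q \<Longrightarrow> lookup (\<beta> (act Q g v)) n = shift_coeff a b g n * lookup (\<beta> v) (n - degree g)"
proof -
  let ?act = "act (intermediate_module a b)"
  have A_simps: "carrier A = {p. keys p \<subseteq> S}" "\<zero>\<^bsub>A\<^esub> = 0" "p \<oplus>\<^bsub>A\<^esub> q = p + q"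
    "c \<odot>\<^bsub>A\<^esub> p = Poly_Mapping.map ((*) c) p" "act A = ?act" for p q c
    by (simp_all add: A_def intermediate_module_def)
  have act_S: "keys (?act g p) \<subseteq> T" if p: "keys p \<subseteq> T"
    and T: "\<And>n m. n \<in> T \<Longrightarrow> n + m \<notin> T \<Longrightarrow> a + of_int n + b * of_int m = 0" for g p T
  proof (cases g)
    case (D m)
    show ?thesis
    proof
      fix n assume "n \<in> keys (?act g p)"
      then have "a + of_int (n - m) + b * of_int m \<noteq> 0" "lookup p (n - m) \<noteq> 0"
        by (auto simp: D lookup_act_intermediate in_keys_iff simp del: of_int_diff)
      with T[of "n - m" m] p show "n \<in> T" by (auto simp: in_keys_iff subset_iff)
    qed
  qed (simp add: act_intermediate_Z)
  interpret A: linear_presentation "\<lambda>c. Poly_Mapping.map ((*) c)" A "{p. keys p \<subseteq> S}" "\<lambda>p. p" ?act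
  proof unfold_locales
    show "?act g p \<in> {p. keys p \<subseteq> S}" if "p \<in> {p. keys p \<subseteq> S}" for g p
      using act_S[of p S g] stays that by auto
    show "?act g (p + q) = ?act g p + ?act g q" for g p q
      by (cases g)
        (auto intro!: poly_mapping_eqI simp: lookup_act_intermediate act_intermediate_Z lookup_add algebra_simps)
  qed (auto simp: A_simps subspace_keys)
  have N: "keys (?act g p) \<subseteq> S - J" if "keys p \<subseteq> S - J" for g p
    using that by (rule act_S) (use stays dies in blast)
  note Nsub = subspace_keys[of "S - J"]
  note q = A.presented_quotient[of "{p. keys p \<subseteq> S - J}", folded Q_def]
  interpret Q: linear_presentation "\<lambda>c. Poly_Mapping.map ((*) c)" Q "{p. keys p \<subseteq> S}"
      "\<lambda>p. {p. keys p \<subseteq> S - J} +>\<^bsub>A\<^esub> p" ?act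
    by (rule q(1))
      (use N pm.subspace_add[OF Nsub] pm.subspace_scale[OF Nsub] in \<open>auto simp: A_simps\<close>)
  have ker: "({p. keys p \<subseteq> S - J} +>\<^bsub>A\<^esub> x = {p. keys p \<subseteq> S - J} +>\<^bsub>A\<^esub> y) \<longleftrightarrow> keys (x - y) \<subseteq> S - J"
    if "keys x \<subseteq> S" "keys y \<subseteq> S" for x y
    using q(2)[of x y] N pm.subspace_add[OF Nsub] pm.subspace_scale[OF Nsub] that
    by (auto simp: A_simps)
  define cut where "cut n c = (if n \<in> J then single n c else 0)" for n and c :: complex
  interpret cut: additive_family cut by unfold_locales (auto simp: cut_def single_add)
  have lookup_cut: "lookup (additive_ext cut p) n = (if n \<in> J then lookup p n else 0)" for p n
  proof -
    have "lookup (additive_ext cut p) n = (\<Sum>i\<in>keys p. if i = n then (if n \<in> J then lookup p n else 0) else 0)"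
      unfolding additive_ext_def lookup_sum
      by (intro sum.cong) (auto simp: cut_def lookup_single when_def)
    then show ?thesis by (simp add: in_keys_iff)
  qed
  have cut_ker: "additive_ext cut x = 0 \<longleftrightarrow> {p. keys p \<subseteq> S - J} +>\<^bsub>A\<^esub> x = {p. keys p \<subseteq> S - J} +>\<^bsub>A\<^esub> 0"
    if "x \<in> {p. keys p \<subseteq> S}" for x
    using that ker[of x 0] by (auto simp: poly_mapping_eq_iff fun_eq_iff lookup_cut in_keys_iff subset_iff)
  have cut_scale: "additive_ext cut (Poly_Mapping.map ((*) c) x) = Poly_Mapping.map ((*) c) (additive_ext cut x)" for c x
    by (rule poly_mapping_eqI) (simp add: lookup_cut)
  obtain \<beta> where \<beta>: "vector_embedding Q (\<lambda>c. Poly_Mapping.map ((*) c)) \<beta>"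
    "\<And>x. x \<in> {p. keys p \<subseteq> S} \<Longrightarrow> \<beta> ({p. keys p \<subseteq> S - J} +>\<^bsub>A\<^esub> x) = additive_ext cut x"
    using Q.embedding_of_linear_map[of "additive_ext cut" "\<lambda>c. Poly_Mapping.map ((*) c)"]
      cut.ext_add cut_scale cut_ker by blast
  show ?thesis
  proof (rule that[OF \<beta>(1)])
    have "\<beta> ` carrier Q = additive_ext cut ` {p. keys p \<subseteq> S}"
      by (simp add: Q.carrier_eq image_image \<beta>(2))
    also have "\<dots> = {q. keys q \<subseteq> J}"
    proof (intro equalityI subsetI)
      fix q :: "int \<Rightarrow>\<^sub>0 complex" assume "q \<in> {q. keys q \<subseteq> J}"
      then have "q = additive_ext cut q" "keys q \<subseteq> S"
        using JS by (auto intro!: poly_mapping_eqI simp: lookup_cut in_keys_iff)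
      then show "q \<in> additive_ext cut ` {p. keys p \<subseteq> S}" by blast
    qed (auto simp: in_keys_iff lookup_cut split: if_splits)
    finally show "\<beta> ` carrier Q = {q. keys q \<subseteq> J}" .
    fix g v n assume "v \<in> carrier Q"
    then obtain p where p: "p \<in> {p. keys p \<subseteq> S}" "v = {p. keys p \<subseteq> S - J} +>\<^bsub>A\<^esub> p"
      by (auto simp: Q.carrier_eq)
    have "\<beta> (act Q g v) = additive_ext cut (?act g p)"
      by (simp only: p(2) Q.act_eq[OF p(1)] \<beta>(2)[OF Q.T_closed[OF p(1)]])
    moreover have "lookup (additive_ext cut (?act g p)) n
        = shift_coeff a b g n * lookup (additive_ext cut p) (n - degree g)"
    proof (cases g)
      case (D m)
      have "(a + of_int (n - m) + b * of_int m) * lookup p (n - m) = 0" if "n \<in> J" "n - m \<notin> J"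
        using dies[of "n - m" m] that p(1) by (cases "n - m \<in> S") (auto simp: in_keys_iff)
      then show ?thesis by (auto simp: D lookup_cut lookup_act_intermediate J_def simp del: of_int_diff)
    qed (simp add: act_intermediate_Z)
    ultimately show "lookup (\<beta> (act Q g v)) n = shift_coeff a b g n * lookup (\<beta> v) (n - degree g)"
      using p by (simp add: \<beta>(2))
  qed
qed

theorem intermediate_simple_embedding:
  obtains \<beta> where "vector_embedding (intermediate_simple a b) (\<lambda>c. Poly_Mapping.map ((*) c)) \<beta>"
    and "\<beta> ` carrier (intermediate_simple a b) = {q. keys q \<subseteq> indices a b}"
    and "\<And>g v n. v \<in> carrier (intermediate_simple a b) \<Longrightarrow>
      lookup (\<beta> (act (intermediate_simple a b) g v)) n
        = shift_coeff a b g n * lookup (\<beta> v) (n - degree g)"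
proof -
  have univ: "intermediate_module a b\<lparr>carrier := {p. keys p \<subseteq> UNIV}\<rparr> = intermediate_module a b"
    by (simp add: intermediate_module_def)
  have int: "a \<in> \<int>" if "of_int n = - a" for n
    using that by (metis Ints_minus Ints_of_int minus_minus)
  have zero: "{p :: int \<Rightarrow>\<^sub>0 complex. keys p \<subseteq> S - S} = {0}" for S
    by (auto simp: poly_mapping_eq_iff fun_eq_iff in_keys_iff)
  \<comment> \<open>\<open>S\<close> is everything if a quotient is taken, and \<open>J\<close> otherwise\<close>
  consider (0) "a \<in> \<int>" "b = 0" | (1) "a \<in> \<int>" "b = 1" | (generic) "\<not> (a \<in> \<int> \<and> (b = 0 \<or> b = 1))" by blast
  then show ?thesis
  proof cases
    case 0
    have N: "{p. keys p \<subseteq> UNIV - indices a b} = {p. \<forall>n\<in>keys p. of_int n = - a}"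
      using 0 by (auto simp: indices_def)
    have "intermediate_simple a b = quotient_module (intermediate_module a b\<lparr>carrier := {p. keys p \<subseteq> UNIV}\<rparr>)
        {p. keys p \<subseteq> UNIV - indices a b}"
      unfolding univ N using 0 by (simp add: intermediate_simple_def Let_def)
    then show ?thesis
      using subquotient_embedding[of a b UNIV thesis] that 0 by (auto simp: indices_def)
  next
    case 1
    have E: "{p. keys p \<subseteq> indices a b} = {p. \<forall>n\<in>keys p. of_int n \<noteq> - a}"
      using 1 by (auto simp: indices_def)
    have "intermediate_simple a b = quotient_module (intermediate_module a b\<lparr>carrier := {p. keys p \<subseteq> indices a b}\<rparr>)
        {p. keys p \<subseteq> indices a b - indices a b}"
      unfolding zero E using 1 by (simp add: intermediate_simple_def Let_def)
    then show ?thesis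
      using subquotient_embedding[of a b "indices a b" thesis] that 1 by (auto simp: indices_def eq_neg_iff_add_eq_0 algebra_simps)
  next
    case generic
    then have J: "indices a b = UNIV" using int by (auto simp: indices_def)
    have "intermediate_simple a b = quotient_module (intermediate_module a b\<lparr>carrier := {p. keys p \<subseteq> UNIV}\<rparr>)
        {p. keys p \<subseteq> UNIV - indices a b}"
      unfolding univ J zero using generic by (auto simp: intermediate_simple_def Let_def)
    then show ?thesis
      using subquotient_embedding[of a b UNIV thesis] that J by auto
  qed
qed

section \<open>Submodules of the tensor product\<close>

text \<open>A sequence none of whose terms depends on the earlier ones spans an infinite-dimensional
  space.\<close>

lemma (in vector_space) finite_span_bounds_chain:
  fixes y :: "nat \<Rightarrow> 'b"
  assumes new: "\<And>n. y n \<notin> span (y ` {..<n})" and fin: "finite B"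
  shows "\<exists>n. y n \<notin> span B"
proof (rule ccontr)
  assume "\<not> ?thesis"
  then have y: "y n \<in> span B" for n by blast
  have indep: "independent (y ` {..<n}) \<and> card (y ` {..<n}) = n" for n
  proof (induction n)
    case (Suc n)
    have "y n \<notin> y ` {..<n}" by (rule contra_subsetD[OF span_superset new])
    then show ?case using Suc new[of n] by (simp add: lessThan_Suc independent_insertI)
  qed (simp add: independent_empty)
  have "y ` {..<Suc (card B)} \<subseteq> span B" using y by auto
  from independent_span_bound[OF fin conjunct1[OF indep] this] indep show False by simp
qed

lemma (in vector_space) vector_space_coefficientwise:
  "vector_space (\<lambda>c. Poly_Mapping.map (scale c) :: ('i \<Rightarrow>\<^sub>0 'b) \<Rightarrow> _)"
proof -
  have "lookup (Poly_Mapping.map (scale c) p) k = scale c (lookup p k)" for c and p :: "'i \<Rightarrow>\<^sub>0 'b" and k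
    by (simp add: map.rep_eq when_def)
  then show ?thesis
    by unfold_locales
      (auto intro!: poly_mapping_eqI simp: lookup_add scale_left_distrib scale_right_distrib)
qed

lemma affine_eventually_nonzero:
  fixes c d :: complex
  assumes "c \<noteq> 0 \<or> d \<noteq> 0"
  shows "\<exists>N. \<forall>l\<ge>N. c + d * of_int l \<noteq> 0"
proof (cases "\<exists>l0. c + d * of_int l0 = 0")
  case True
  then obtain l0 where l0: "c + d * of_int l0 = 0" by blast
  with assms have "d \<noteq> 0" by auto
  have "l = l0" if "c + d * of_int l = 0" for l
  proof -
    have "d * of_int l = d * of_int l0" using that l0 by (metis add_left_cancel)
    with \<open>d \<noteq> 0\<close> show ?thesis by simp
  qed
  then show ?thesis by (intro exI[of _ "l0 + 1"]) force
qed blast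

text \<open>The index \<open>i + l\<close> is omitted for at most one \<open>l\<close>. Otherwise the coefficient is affine in \<open>l\<close>,
  and it could vanish identically only for \<open>b = 0\<close> and \<open>i = - a\<close>, an index that the simple
  subquotient omits.\<close>

lemma shift_coeff_eventually_nonzero:
  assumes i: "i \<in> indices a b"
  shows "\<exists>N. \<forall>l\<ge>N. shift_coeff a b (D l) (i + l) \<noteq> 0"
proof -
  obtain N1 where N1: "\<And>l. l \<ge> N1 \<Longrightarrow> a + of_int i + 1 * of_int l \<noteq> 0"
    using affine_eventually_nonzero[of "a + of_int i" 1] by auto
  have "a + of_int i \<noteq> 0 \<or> b \<noteq> 0"
    using i by (auto simp: indices_def eq_neg_iff_add_eq_0 add.commute)
  then obtain N2 where N2: "\<And>l. l \<ge> N2 \<Longrightarrow> a + of_int i + b * of_int l \<noteq> 0"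
    using affine_eventually_nonzero by blast
  have "shift_coeff a b (D l) (i + l) \<noteq> 0" if "l \<ge> max N1 N2" for l
    using N1[of l] N2[of l] that by (auto simp: indices_def eq_neg_iff_add_eq_0 ac_simps)
  then show ?thesis by blast
qed

text \<open>Coordinates of a module \<open>L\<close> that is isomorphic to a submodule of the tensor product: \<open>f\<close>
  composes the isomorphism with the components of the tensor product, and \<open>U\<close> is the embedded
  highest weight module.\<close>

locale tensor_coordinates = vector_space s
  for s :: "complex \<Rightarrow> 'e::ab_group_add \<Rightarrow> 'e" +
  fixes L :: "(vir, 'l) rep" and f :: "'l \<Rightarrow> int \<Rightarrow>\<^sub>0 'e" and A :: "vir \<Rightarrow> 'e \<Rightarrow> 'e"
    and U :: "'e set" and a b :: complex
  assumes f_inj: "inj_on f (carrier L)"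
    and f_add: "x \<in> carrier L \<Longrightarrow> y \<in> carrier L \<Longrightarrow> f (x \<oplus>\<^bsub>L\<^esub> y) = f x + f y"
    and f_smult: "x \<in> carrier L \<Longrightarrow> f (c \<odot>\<^bsub>L\<^esub> x) = Poly_Mapping.map (s c) (f x)"
    and f_act: "x \<in> carrier L \<Longrightarrow> lookup (f (act L (D m) x)) n
      = A (D m) (lookup (f x) n) + s (shift_coeff a b (D m) n) (lookup (f x) (n - m))"
    and f_keys: "x \<in> carrier L \<Longrightarrow> keys (f x) \<subseteq> indices a b"
    and f_U: "x \<in> carrier L \<Longrightarrow> lookup (f x) n \<in> U"
    and A_add: "A g (u + v) = A g u + A g v" and A_scale: "A g (s c u) = s c (A g u)"
    and raising: "u \<in> U \<Longrightarrow> \<exists>N. \<forall>k\<ge>N. A (D k) u = 0"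
    and lowering: "(\<forall>u\<in>U. u \<noteq> 0 \<longrightarrow> (\<exists>N. \<forall>m\<ge>N. A (D (- m)) u \<noteq> 0)) \<or>
      (\<forall>u\<in>U. A (D 0) u = 0) \<and> (\<exists>u0. \<forall>u\<in>U. \<exists>c. u = s c u0)"
begin

interpretation pms: vector_space "\<lambda>c. Poly_Mapping.map (s c) :: (int \<Rightarrow>\<^sub>0 'e) \<Rightarrow> _"
  by (rule vector_space_coefficientwise)

lemma lookup_map_s: "lookup (Poly_Mapping.map (s c) p) n = s c (lookup p n)"
  by (simp add: map.rep_eq when_def)

lemma A_zero: "A g 0 = 0"
  using A_add[of g 0 0] by simp

text \<open>Let \<open>i\<close> be the largest index in the support of \<open>z\<close>. For large \<open>l\<close> the operator \<open>D l\<close> kills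
  all highest weight components and only shifts \<open>z\<close> to the right by \<open>l\<close>. Applying \<open>D (- l)\<close> then
  leaves in position \<open>i + l\<close> a nonzero multiple of \<open>D (- l)\<close> applied to the top component, and
  nothing further to the right. The leading positions of these vectors increase with \<open>l\<close>, so they
  cannot lie in a finite-dimensional space.\<close>

lemma lowering_raising_infinite:
  assumes low: "\<forall>u\<in>U. u \<noteq> 0 \<longrightarrow> (\<exists>N. \<forall>m\<ge>N. A (D (- m)) u \<noteq> 0)"
    and z: "z \<in> carrier L" "f z \<noteq> 0"
    and closed: "\<And>l. l > 0 \<Longrightarrow> even l \<Longrightarrow> act L (D l) z \<in> carrier L"
    and fin: "finite B"
  shows "\<exists>l>0. even l \<and> f (act L (D (- l)) (act L (D l) z)) \<notin> pms.span B"
proof -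
  let ?q = "f z"
  define i where "i = Max (keys ?q)"
  have "keys ?q \<noteq> {}" using z(2) by (auto simp: poly_mapping_eq_iff fun_eq_iff in_keys_iff)
  then have i: "i \<in> keys ?q" unfolding i_def by (intro Max_in finite_keys)
  have top: "lookup ?q n = 0" if "n > i" for n
  proof (rule ccontr)
    assume "lookup ?q n \<noteq> 0"
    then have "n \<le> i" unfolding i_def by (intro Max_ge finite_keys) (simp add: in_keys_iff)
    with that show False by simp
  qed
  have "\<forall>n\<in>keys ?q. \<forall>\<^sub>F k in at_top. A (D k) (lookup ?q n) = 0"
    using raising f_U[OF z(1)] by (auto simp: eventually_at_top_linorder)
  then have "\<forall>\<^sub>F k in at_top. \<forall>n\<in>keys ?q. A (D k) (lookup ?q n) = 0"
    by (rule eventually_ball_finite[OF finite_keys])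
  then obtain N1 where "\<And>k n. k \<ge> N1 \<Longrightarrow> n \<in> keys ?q \<Longrightarrow> A (D k) (lookup ?q n) = 0"
    by (auto simp: eventually_at_top_linorder)
  then have N1: "k \<ge> N1 \<Longrightarrow> A (D k) (lookup ?q n) = 0" for k n
    using A_zero by (cases "n \<in> keys ?q") (auto simp: in_keys_iff)
  obtain N2 where N2: "\<And>l. l \<ge> N2 \<Longrightarrow> A (D (- l)) (lookup ?q i) \<noteq> 0"
    using low f_U[OF z(1), of i] i unfolding in_keys_iff by blast
  obtain N3 where N3: "\<And>l. l \<ge> N3 \<Longrightarrow> shift_coeff a b (D l) (i + l) \<noteq> 0"
    using shift_coeff_eventually_nonzero f_keys[OF z(1)] i by blast
  define N where "N = max 1 (max N1 (max N2 N3))"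
  let ?y = "\<lambda>l. f (act L (D (- l)) (act L (D l) z))"
  have coord: "lookup (?y l) n = A (D (- l)) (s (shift_coeff a b (D l) n) (lookup ?q (n - l)))
      + s (shift_coeff a b (D (- l)) n) (s (shift_coeff a b (D l) (n + l)) (lookup ?q n))"
    if "l \<ge> N" "even l" for l n
  proof -
    have "act L (D l) z \<in> carrier L" using closed that by (simp add: N_def)
    then show ?thesis using that by (simp add: f_act z(1) N1 N_def del: shift_coeff.simps)
  qed
  have top_coord: "lookup (?y l) (i + l) \<noteq> 0" if "l \<ge> N" "even l" for l
    using that N2[of l] N3[of l] by (simp add: coord top N_def A_scale del: shift_coeff.simps)
  have zero_coord: "lookup (?y k) (i + l) = 0" if "k \<ge> N" "even k" "k < l" for k l
    using that by (simp add: coord top N_def A_zero del: shift_coeff.simps)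
  \<comment> \<open>even indices beyond every bound found so far\<close>
  define l where "l n = 2 * (int n + N)" for n
  have l: "l n \<ge> N" "even (l n)" "m < n \<Longrightarrow> l m < l n" for m n by (auto simp: l_def N_def)
  have "?y (l n) \<notin> pms.span ((\<lambda>n. ?y (l n)) ` {..<n})" for n
  proof
    assume "?y (l n) \<in> pms.span ((\<lambda>n. ?y (l n)) ` {..<n})"
    moreover have "pms.subspace {v. lookup v (i + l n) = 0}"
      by (rule pms.subspaceI) (auto simp: lookup_add lookup_map_s)
    moreover have "(\<lambda>n. ?y (l n)) ` {..<n} \<subseteq> {v. lookup v (i + l n) = 0}"
      using zero_coord l by auto
    ultimately have "lookup (?y (l n)) (i + l n) = 0" using pms.span_minimal by blast
    with top_coord[OF l(1,2)] show False by simp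
  qed
  from pms.finite_span_bounds_chain[of "\<lambda>n. ?y (l n)", OF this fin]
  obtain n where "?y (l n) \<notin> pms.span B" by blast
  moreover have "l n > 0" using l(1)[of n] by (simp add: N_def)
  ultimately show ?thesis using l(2) by blast
qed

text \<open>For a trivial first factor the tensor product is the intermediate series itself, on which
  \<open>D 0\<close> has simple spectrum.\<close>

lemma weight_spaces_one_dimensional:
  assumes triv: "\<forall>u\<in>U. A (D 0) u = 0" "\<forall>u\<in>U. \<exists>c. u = s c u0"
    and x: "x \<in> carrier L" "f x \<noteq> 0" "act L (D 0) x = \<mu> \<odot>\<^bsub>L\<^esub> x"
    and y: "y \<in> carrier L" "act L (D 0) y = \<mu> \<odot>\<^bsub>L\<^esub> y"
    and smult: "\<And>c. c \<odot>\<^bsub>L\<^esub> x \<in> carrier L"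
  shows "\<exists>c. y = c \<odot>\<^bsub>L\<^esub> x"
proof -
  have supp: "a + of_int n = \<mu>" if "v \<in> carrier L" "act L (D 0) v = \<mu> \<odot>\<^bsub>L\<^esub> v" "n \<in> keys (f v)" for v n
  proof -
    have n: "n \<in> indices a b" using f_keys that by blast
    have "s \<mu> (lookup (f v) n) = s (a + of_int n) (lookup (f v) n)"
      using f_act[OF that(1), of 0 n] f_smult[OF that(1), of \<mu>] triv(1) f_U[OF that(1), of n] n
      by (simp add: that(2) lookup_map_s)
    with that(3) show ?thesis by (simp add: in_keys_iff)
  qed
  from x(2) obtain n where n: "n \<in> keys (f x)"
    by (auto simp: poly_mapping_eq_iff fun_eq_iff in_keys_iff)
  have other: "k \<in> keys (f v) \<Longrightarrow> v \<in> {x, y} \<Longrightarrow> k = n" for k v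
    using supp[OF x(1,3) n] supp[OF x(1,3), of k] supp[OF y, of k] by auto
  obtain c d where cd: "lookup (f x) n = s c u0" "lookup (f y) n = s d u0"
    using triv(2) f_U x(1) y(1) by meson
  with n have "c \<noteq> 0" by (auto simp: in_keys_iff)
  have "f y = f ((d / c) \<odot>\<^bsub>L\<^esub> x)"
  proof (rule poly_mapping_eqI)
    fix k
    show "lookup (f y) k = lookup (f ((d / c) \<odot>\<^bsub>L\<^esub> x)) k"
    proof (cases "k = n")
      case True
      then show ?thesis using cd \<open>c \<noteq> 0\<close> by (simp add: f_smult x(1) lookup_map_s)
    next
      case False
      then have "lookup (f x) k = 0" "lookup (f y) k = 0"
        using other[of k x] other[of k y] by (auto simp: in_keys_iff)
      then show ?thesis by (simp add: f_smult x(1) lookup_map_s)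
    qed
  qed
  with f_inj y(1) smult show ?thesis by (auto dest: inj_onD)
qed

text \<open>The two cases combined: if some nonzero \<open>z\<close> has all its \<open>D (- l) (D l z)\<close>, for positive
  even \<open>l\<close>, in a finite-dimensional space, then the weight spaces are lines. The restriction to even
  \<open>l\<close> is what makes the criterion easy to apply to the two halves of the loop module at \<open>- 1\<close>.\<close>

theorem finite_orbit_weight_space:
  assumes z: "z \<in> carrier L" "f z \<noteq> 0"
    and closed: "\<And>l. l > 0 \<Longrightarrow> even l \<Longrightarrow> act L (D l) z \<in> carrier L"
    and fin: "finite B"
    and orbit: "\<And>l. l > 0 \<Longrightarrow> even l \<Longrightarrow> f (act L (D (- l)) (act L (D l) z)) \<in> pms.span B"
    and x: "x \<in> carrier L" "f x \<noteq> 0" "act L (D 0) x = \<mu> \<odot>\<^bsub>L\<^esub> x"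
    and y: "y \<in> carrier L" "act L (D 0) y = \<mu> \<odot>\<^bsub>L\<^esub> y"
    and smult: "\<And>c. c \<odot>\<^bsub>L\<^esub> x \<in> carrier L"
  shows "\<exists>c. y = c \<odot>\<^bsub>L\<^esub> x"
  using lowering
proof
  assume "\<forall>u\<in>U. u \<noteq> 0 \<longrightarrow> (\<exists>N. \<forall>m\<ge>N. A (D (- m)) u \<noteq> 0)"
  from lowering_raising_infinite[OF this z closed fin] orbit show ?thesis by blast
next
  assume "(\<forall>u\<in>U. A (D 0) u = 0) \<and> (\<exists>u0. \<forall>u\<in>U. \<exists>c. u = s c u0)"
  with weight_spaces_one_dimensional x y smult show ?thesis by blast
qed

end

lemma coordinates_of_submodule:
  assumes J: "maximal_submodule virasoro (verma c h) J" and V: "V = quotient_module (verma c h) J"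
    and iso: "isomorphic_to_simple_submodule virasoro L (tensor_module V (intermediate_simple a b))"
  obtains f :: "_ \<Rightarrow> int \<Rightarrow>\<^sub>0 vir free_algebra" and A U
  where "tensor_coordinates (\<lambda>c q. scalar c * q) L f A U a b"
proof -
  let ?I = "intermediate_simple a b" and ?s = "\<lambda>c (q :: vir free_algebra). scalar c * q"
  obtain \<iota> :: "_ \<Rightarrow> vir free_algebra" and A where \<iota>: "vector_embedding V ?s \<iota>"
    and A: "\<And>g x y. A g (x + y) = A g x + A g y" "\<And>g c x. A g (scalar c * x) = scalar c * A g x"
      "\<And>g u. u \<in> carrier V \<Longrightarrow> \<iota> (act V g u) = A g (\<iota> u)"
      "\<And>x. x \<in> \<iota> ` carrier V \<Longrightarrow> \<exists>N. \<forall>k\<ge>N. A (D k) x = 0"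
      "(\<forall>x\<in>\<iota> ` carrier V. x \<noteq> 0 \<longrightarrow> (\<exists>N. \<forall>m\<ge>N. A (D (- m)) x \<noteq> 0)) \<or>
         (\<forall>x\<in>\<iota> ` carrier V. A (D 0) x = 0) \<and> (\<exists>x0. \<forall>x\<in>\<iota> ` carrier V. \<exists>c. x = scalar c * x0)"
    by (rule simple_highest_weight_module_embedding[OF J V]) (rule that)
  obtain \<beta> where \<beta>: "vector_embedding ?I (\<lambda>c. Poly_Mapping.map ((*) c)) \<beta>"
    "\<beta> ` carrier ?I = {q. keys q \<subseteq> indices a b}"
    "\<And>g v n. v \<in> carrier ?I \<Longrightarrow> lookup (\<beta> (act ?I g v)) n = shift_coeff a b g n * lookup (\<beta> v) (n - degree g)"
    by (rule intermediate_simple_embedding[of a b]) (rule that)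
  have te: "tensor_embedding ?s V \<iota> ?I \<beta> (indices a b) A (shift_coeff a b) degree"
    by (intro tensor_embedding.intro tensor_embedding_axioms.intro free.vector_space_axioms \<iota> \<beta> A)
  let ?T = "tensor_module V ?I"
  obtain \<theta> where \<theta>: "vector_embedding ?T (\<lambda>c. Poly_Mapping.map (?s c)) \<theta>"
    "\<And>x g n. x \<in> carrier ?T \<Longrightarrow> lookup (\<theta> (act ?T g x)) n
        = A g (lookup (\<theta> x) n) + scalar (shift_coeff a b g n) * (lookup (\<theta> x) (n - degree g))"
    "\<And>x. x \<in> carrier ?T \<Longrightarrow> keys (\<theta> x) \<subseteq> indices a b"
    "\<And>x n. x \<in> carrier ?T \<Longrightarrow> lookup (\<theta> x) n \<in> \<iota> ` carrier V"
    by (rule tensor_embedding.embedding[OF te]) (rule that)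
  from iso obtain N where N: "lie_submodule virasoro ?T N"
    and "isomorphic_modules virasoro L (?T\<lparr>carrier := N\<rparr>)"
    unfolding isomorphic_to_simple_submodule_def by blast
  then obtain f where f: "f \<in> Group.iso (add_monoid L) (add_monoid (?T\<lparr>carrier := N\<rparr>))"
    "\<And>c v. v \<in> carrier L \<Longrightarrow> f (c \<odot>\<^bsub>L\<^esub> v) = c \<odot>\<^bsub>?T\<^esub> f v"
    "\<And>g v. v \<in> carrier L \<Longrightarrow> f (act L g v) = act ?T g (f v)"
    unfolding isomorphic_modules_def by (auto simp: virasoro_def)
  have NT: "N \<subseteq> carrier ?T"
    using N submodule_closed(1) unfolding lie_submodule_def by blast
  have fN: "x \<in> carrier L \<Longrightarrow> f x \<in> carrier ?T" for x
    using f(1) NT by (auto simp: Group.iso_def hom_def)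
  have f_add: "f (x \<oplus>\<^bsub>L\<^esub> y) = f x \<oplus>\<^bsub>?T\<^esub> f y" if "x \<in> carrier L" "y \<in> carrier L" for x y
    using f(1) that by (auto simp: Group.iso_def hom_def)
  have f_inj: "inj_on f (carrier L)"
    using f(1) by (auto simp: Group.iso_def bij_betw_def)
  interpret T: vector_embedding ?T "\<lambda>c. Poly_Mapping.map (?s c)" \<theta> by (rule \<theta>(1))
  have "inj_on (\<theta> \<circ> f) (carrier L)"
    by (rule comp_inj_on[OF f_inj inj_on_subset[OF T.emb_inj]]) (use fN in blast)
  then have "tensor_coordinates ?s L (\<theta> \<circ> f) A (\<iota> ` carrier V) a b"
    by (intro tensor_coordinates.intro tensor_coordinates_axioms.intro free.vector_space_axioms A)
      (simp_all add: fN f_add f(2,3) T.emb_add T.emb_smult \<theta>(2-4))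
  then show ?thesis by (rule that)
qed

section \<open>Loop modules\<close>

text \<open>Modules over the derivations of the polynomial ring, with the vector space laws
  in a form suited to rewriting by complex scalars.\<close>

locale witt_representation =
  fixes W :: "(int, 'w) rep"
  assumes lie: "lie_module witt W"

sublocale witt_representation \<subseteq> Module.module complex_ring W
  using lie by (simp add: lie_module_def)

context witt_representation
begin

lemma act_closed: "i \<ge> -1 \<Longrightarrow> v \<in> carrier W \<Longrightarrow> act W i v \<in> carrier W"
  and act_add: "i \<ge> -1 \<Longrightarrow> v \<in> carrier W \<Longrightarrow> w \<in> carrier W \<Longrightarrow>
    act W i (v \<oplus>\<^bsub>W\<^esub> w) = act W i v \<oplus>\<^bsub>W\<^esub> act W i w"
  and act_smult: "i \<ge> -1 \<Longrightarrow> v \<in> carrier W \<Longrightarrow> act W i (c \<odot>\<^bsub>W\<^esub> v) = c \<odot>\<^bsub>W\<^esub> act W i v"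
  using lie by (auto simp: lie_module_def witt_def)

lemma scalar_closed [simp]: "v \<in> carrier W \<Longrightarrow> c \<odot>\<^bsub>W\<^esub> v \<in> carrier W"
  by (rule smult_closed) simp_all

lemma smult_zero [simp]: "v \<in> carrier W \<Longrightarrow> 0 \<odot>\<^bsub>W\<^esub> v = \<zero>\<^bsub>W\<^esub>"
  using smult_l_null by simp

lemma smult_of_zero [simp]: "c \<odot>\<^bsub>W\<^esub> \<zero>\<^bsub>W\<^esub> = \<zero>\<^bsub>W\<^esub>"
  using smult_r_null by simp

lemma smult_one_eq [simp]: "v \<in> carrier W \<Longrightarrow> 1 \<odot>\<^bsub>W\<^esub> v = v"
  using smult_one by simp

lemma smult_smult: "v \<in> carrier W \<Longrightarrow> c \<odot>\<^bsub>W\<^esub> (d \<odot>\<^bsub>W\<^esub> v) = (c * d) \<odot>\<^bsub>W\<^esub> v"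
  using smult_assoc1[of c d v] by simp

lemma smult_sum: "v \<in> carrier W \<Longrightarrow> (c + d) \<odot>\<^bsub>W\<^esub> v = c \<odot>\<^bsub>W\<^esub> v \<oplus>\<^bsub>W\<^esub> d \<odot>\<^bsub>W\<^esub> v"
  using smult_l_distr[of c d v] by simp

lemma smult_add: "v \<in> carrier W \<Longrightarrow> w \<in> carrier W \<Longrightarrow> c \<odot>\<^bsub>W\<^esub> (v \<oplus>\<^bsub>W\<^esub> w) = c \<odot>\<^bsub>W\<^esub> v \<oplus>\<^bsub>W\<^esub> c \<odot>\<^bsub>W\<^esub> w"
  using smult_r_distr[of c v w] by simp

lemma minus_eq_smult: "v \<in> carrier W \<Longrightarrow> \<ominus>\<^bsub>W\<^esub> v = (-1) \<odot>\<^bsub>W\<^esub> v"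
  by (rule minus_equality) (use smult_sum[of v "-1" 1] in \<open>auto\<close>)

lemma smult_eq_zeroD: "c \<odot>\<^bsub>W\<^esub> v = \<zero>\<^bsub>W\<^esub> \<Longrightarrow> c \<noteq> 0 \<Longrightarrow> v \<in> carrier W \<Longrightarrow> v = \<zero>\<^bsub>W\<^esub>"
  using smult_smult[of v "inverse c" c] by simp

lemma act_zero: "i \<ge> -1 \<Longrightarrow> act W i \<zero>\<^bsub>W\<^esub> = \<zero>\<^bsub>W\<^esub>"
  using act_smult[of i "\<zero>\<^bsub>W\<^esub>" 0] by (simp add: act_closed)

lemma act_commute:
  assumes "i \<ge> -1" "j \<ge> -1" "i \<noteq> j" "v \<in> carrier W"
  shows "act W i (act W j v) = act W j (act W i v) \<oplus>\<^bsub>W\<^esub> of_int (j - i) \<odot>\<^bsub>W\<^esub> act W (i + j) v"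
proof -
  have ij: "i + j \<ge> -1" using assms by linarith
  have "act W i (act W j v) \<ominus>\<^bsub>W\<^esub> act W j (act W i v)
      = finsum W (\<lambda>k. lookup (bracket witt i j) k \<odot>\<^bsub>W\<^esub> act W k v) (keys (bracket witt i j))"
    using lie assms by (auto simp: lie_module_def witt_def)
  also have "\<dots> = of_int (j - i) \<odot>\<^bsub>W\<^esub> act W (i + j) v"
    using assms ij by (simp add: witt_def act_closed add.commute)
  finally have eq: "act W i (act W j v) \<ominus>\<^bsub>W\<^esub> act W j (act W i v) = of_int (j - i) \<odot>\<^bsub>W\<^esub> act W (i + j) v" .
  have "p = q \<oplus>\<^bsub>W\<^esub> (p \<ominus>\<^bsub>W\<^esub> q)" if "p \<in> carrier W" "q \<in> carrier W" for p q
    using that by (simp add: minus_eq a_lcomm[of q p] r_neg)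
  from this[of "act W i (act W j v)" "act W j (act W i v)"] show ?thesis
    using assms by (simp only: eq act_closed)
qed

lemma exp_der_atMost:
  assumes v: "v \<in> carrier W" and vanish: "\<And>i. i > int n - 1 \<Longrightarrow> act W i v = \<zero>\<^bsub>W\<^esub>"
  shows "exp_der W k v = finsum W (\<lambda>i::nat. (of_int k ^ i / fact i) \<odot>\<^bsub>W\<^esub> act W (int i - 1) v) {..n}"
  unfolding exp_der_def
proof (rule add.finprod_mono_neutral_cong_left)
  show "{i. act W (int i - 1) v \<noteq> \<zero>\<^bsub>W\<^esub>} \<subseteq> {..n}"
  proof
    fix i :: nat assume "i \<in> {i. act W (int i - 1) v \<noteq> \<zero>\<^bsub>W\<^esub>}"
    then have "\<not> int i - 1 > int n - 1" using vanish by auto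
    then show "i \<in> {..n}" by simp
  qed
qed (auto simp: act_closed v)

lemma exp_der_0:
  assumes v: "v \<in> carrier W" and vanish: "\<And>i. i \<ge> int n \<Longrightarrow> act W i v = \<zero>\<^bsub>W\<^esub>"
  shows "exp_der W 0 v = act W (-1) v"
proof -
  have "finsum W (\<lambda>i::nat. (of_int 0 ^ i / fact i) \<odot>\<^bsub>W\<^esub> act W (int i - 1) v) {..m} = act W (-1) v" for m
    by (induction m) (simp_all add: act_closed v Pi_def)
  then show ?thesis using exp_der_atMost[of v "Suc n" 0] v vanish by simp
qed

lemma exp_der_of_zero: "exp_der W k \<zero>\<^bsub>W\<^esub> = \<zero>\<^bsub>W\<^esub>"
  by (simp add: exp_der_def act_zero)

lemma exp_der_closed: "v \<in> carrier W \<Longrightarrow> exp_der W k v \<in> carrier W"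
  unfolding exp_der_def by (rule finsum_closed) (simp add: act_closed)

lemma loop_coeff_of_zero: "loop_coeff W lam a b k j \<zero>\<^bsub>W\<^esub> = \<zero>\<^bsub>W\<^esub>"
  by (simp add: loop_coeff_def exp_der_of_zero act_zero minus_eq)

lemma loop_coeff_0:
  assumes v: "v \<in> carrier W" and vanish: "\<And>i. i \<ge> int n \<Longrightarrow> act W i v = \<zero>\<^bsub>W\<^esub>"
  shows "loop_coeff W lam a b 0 j v = (a + of_int j) \<odot>\<^bsub>W\<^esub> v"
  using exp_der_0[OF assms] v by (simp add: loop_coeff_def minus_eq r_neg act_closed)

lemma laurent_term_closed: "v \<in> carrier W \<Longrightarrow> laurent_term W v j \<in> carrier (loop_module W lam a b)"
  by (auto simp: laurent_term_def loop_module_def)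

lemma laurent_term_add: "v \<in> carrier W \<Longrightarrow> w \<in> carrier W \<Longrightarrow>
    laurent_term W (v \<oplus>\<^bsub>W\<^esub> w) j = laurent_term W v j \<oplus>\<^bsub>loop_module W lam a b\<^esub> laurent_term W w j"
  by (auto simp: laurent_term_def loop_module_def)

lemma laurent_term_smult: "v \<in> carrier W \<Longrightarrow>
    laurent_term W (c \<odot>\<^bsub>W\<^esub> v) j = c \<odot>\<^bsub>loop_module W lam a b\<^esub> laurent_term W v j"
  by (auto simp: laurent_term_def loop_module_def)

lemma act_laurent_term: "v \<in> carrier W \<Longrightarrow>
    act (loop_module W lam a b) (D k) (laurent_term W v j)
      = laurent_term W (loop_coeff W lam a b k j v) (j + k)"
  by (auto simp: laurent_term_def loop_module_def loop_coeff_of_zero)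

lemma laurent_term_inj: "laurent_term W v j = laurent_term W w j \<Longrightarrow> v = w"
  by (auto simp: laurent_term_def dest: fun_cong[of _ _ j])

text \<open>The finitely many vectors that occur in the action of all loop operators on
  \<open>v\<close>: only the coefficients depend on the operator.\<close>

definition derived :: "'w \<Rightarrow> 'w set" where
  "derived v = insert v (insert (act W (-1) v)
     ((\<lambda>i::nat. act W (int i - 1) v) ` {i. act W (int i - 1) v \<noteq> \<zero>\<^bsub>W\<^esub>}))"

lemma derived_closed: "v \<in> carrier W \<Longrightarrow> derived v \<subseteq> carrier W"
  by (auto simp: derived_def act_closed)

lemma derived_finite: assumes "\<And>i. i \<ge> int n \<Longrightarrow> act W i v = \<zero>\<^bsub>W\<^esub>" shows "finite (derived v)"
proof -
  have "{i::nat. act W (int i - 1) v \<noteq> \<zero>\<^bsub>W\<^esub>} \<subseteq> {..n}"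
  proof
    fix i :: nat assume "i \<in> {i. act W (int i - 1) v \<noteq> \<zero>\<^bsub>W\<^esub>}"
    then have "\<not> int i - 1 \<ge> int n" using assms by auto
    then show "i \<in> {..n}" by simp
  qed
  then show ?thesis unfolding derived_def by (meson finite.insertI finite_imageI finite_subset finite_atMost)
qed

lemma loop_coeff_in_span:
  fixes h :: "'w \<Rightarrow> 'e::ab_group_add"
  assumes vs: "vector_space s"
    and h_add: "\<And>v w. v \<in> carrier W \<Longrightarrow> w \<in> carrier W \<Longrightarrow> h (v \<oplus>\<^bsub>W\<^esub> w) = h v + h w"
    and h_smult: "\<And>c v. v \<in> carrier W \<Longrightarrow> h (c \<odot>\<^bsub>W\<^esub> v) = s c (h v)"
    and v: "v \<in> carrier W"
  shows "h (loop_coeff W lam a b k j v) \<in> Modules.module.span s (h ` derived v)"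
proof -
  interpret vector_space s by (rule vs)
  have h0: "h \<zero>\<^bsub>W\<^esub> = 0" using h_add[of "\<zero>\<^bsub>W\<^esub>" "\<zero>\<^bsub>W\<^esub>"] by simp
  have h_finsum: "h (finsum W g B) = (\<Sum>i\<in>B. h (g i))" if "g \<in> B \<rightarrow> carrier W" for g :: "nat \<Rightarrow> 'w" and B
    using that
    by (induction B rule: infinite_finite_induct) (simp_all add: h0 h_add Pi_def)
  have in_span: "h u \<in> span (h ` derived v)" if "u \<in> derived v" for u
    using that by (intro span_base) blast
  have "h (exp_der W k v) \<in> span (h ` derived v)"
    unfolding exp_der_def
    by (subst h_finsum)
      (auto simp: act_closed v h_smult intro!: span_sum span_scale in_span, auto simp: derived_def)
  moreover have "h v \<in> span (h ` derived v)" "h (act W (-1) v) \<in> span (h ` derived v)"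
    by (rule in_span, simp add: derived_def)+
  ultimately show ?thesis
    by (auto simp: loop_coeff_def minus_eq minus_eq_smult h_add h_smult act_closed exp_der_closed v
        intro!: span_add span_diff span_scale span_neg)
qed

text \<open>On a line all operators commute, so that every \<open>d\<^sub>i\<^sub>+\<^sub>j\<close> with \<open>i \<noteq> j\<close>, being a multiple of a
  commutator, vanishes.\<close>

lemma one_dimensional_trivial:
  assumes v: "v \<in> carrier W" and dim: "\<And>w. w \<in> carrier W \<Longrightarrow> \<exists>c. w = c \<odot>\<^bsub>W\<^esub> v" and g: "g \<ge> -1"
  shows "act W g v = \<zero>\<^bsub>W\<^esub>"
proof -
  have zero: "act W (i + j) v = \<zero>\<^bsub>W\<^esub>" if ij: "i \<ge> -1" "j \<ge> -1" "i \<noteq> j" for i j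
  proof -
    obtain c d where cd: "act W i v = c \<odot>\<^bsub>W\<^esub> v" "act W j v = d \<odot>\<^bsub>W\<^esub> v"
      using dim act_closed v ij by meson
    have "act W i (act W j v) = act W j (act W i v)"
      using ij v by (simp add: cd act_smult smult_smult mult.commute)
    with act_commute[OF ij v] have "of_int (j - i) \<odot>\<^bsub>W\<^esub> act W (i + j) v = \<zero>\<^bsub>W\<^esub>"
      using ij v by (simp add: act_closed del: of_int_diff)
    then show ?thesis by (rule smult_eq_zeroD) (use ij v in \<open>auto intro: act_closed\<close>)
  qed
  show ?thesis using zero[of 0 g] zero[of 1 "-1"] g by (cases "g = 0") auto
qed

end

lemma (in tensor_coordinates) nonzero_image:
  assumes "z \<in> carrier L" "0 \<odot>\<^bsub>L\<^esub> z \<in> carrier L" "0 \<odot>\<^bsub>L\<^esub> z \<noteq> z"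
  shows "f z \<noteq> 0"
proof
  assume "f z = 0"
  then have "f (0 \<odot>\<^bsub>L\<^esub> z) = f z"
    using assms by (auto intro!: poly_mapping_eqI simp: f_smult lookup_map_s)
  with assms f_inj show False by (auto dest: inj_onD)
qed

text \<open>For all \<open>l\<close> the vector \<open>D (- l) (D l (v \<otimes> 1))\<close> is a combination, with coefficients
  depending on \<open>l\<close>, of the fixed finite set of second derived vectors of \<open>v\<close>. So the weight spaces
  are lines; but they are copies of \<open>W\<close>, and a nontrivial \<open>W\<close> is not a line.\<close>

theorem loop_module_not_in_tensor:
  assumes O: "category_O W" and nontriv: "nontrivial_module witt W"
    and simple: "simple_module virasoro (loop_module W lam a b)"
    and tc: "tensor_coordinates s (loop_module W lam a b) f A U a1 b1"
  shows False
proof -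
  let ?L = "loop_module W lam a b"
  interpret witt_representation W using O by unfold_locales (simp add: category_O_def)
  interpret tensor_coordinates s ?L f A U a1 b1 by (rule tc)
  interpret pms: vector_space "\<lambda>c. Poly_Mapping.map (s c) :: (int \<Rightarrow>\<^sub>0 _) \<Rightarrow> _"
    by (rule vector_space_coefficientwise)
  have vanish: "\<exists>n. \<forall>i\<ge>int n. act W i v = \<zero>\<^bsub>W\<^esub>" if "v \<in> carrier W" for v
    using O that by (simp add: category_O_def)
  from simple have Lie: "lie_module virasoro ?L" by (simp add: simple_module_def)
  then have L_closed: "x \<in> carrier ?L \<Longrightarrow> act ?L g x \<in> carrier ?L"
    and L_add: "x \<in> carrier ?L \<Longrightarrow> y \<in> carrier ?L \<Longrightarrow> act ?L g (x \<oplus>\<^bsub>?L\<^esub> y) = act ?L g x \<oplus>\<^bsub>?L\<^esub> act ?L g y"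
    and L_smult: "x \<in> carrier ?L \<Longrightarrow> act ?L g (c \<odot>\<^bsub>?L\<^esub> x) = c \<odot>\<^bsub>?L\<^esub> act ?L g x" for g x y c
    by (auto simp: lie_module_def virasoro_def)
  from nontriv obtain g v where g: "g \<ge> -1" and v: "v \<in> carrier W" and gv: "act W g v \<noteq> \<zero>\<^bsub>W\<^esub>"
    by (auto simp: nontrivial_module_def witt_def)
  let ?t = "\<lambda>v. laurent_term W v 0"
  have t: "w \<in> carrier W \<Longrightarrow> laurent_term W w j \<in> carrier ?L" for w j by (rule laurent_term_closed)
  have "f (?t v) \<noteq> 0"
  proof (rule nonzero_image)
    show "0 \<odot>\<^bsub>?L\<^esub> ?t v \<noteq> ?t v"
      using laurent_term_inj[of "0 \<odot>\<^bsub>W\<^esub> v" 0 v] gv g act_zero v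
      by (auto simp flip: laurent_term_smult)
  qed (use v t in \<open>auto simp flip: laurent_term_smult\<close>)
  define B where "B = (\<Union>u\<in>derived v. (\<lambda>w. f (?t w)) ` derived u)"
  have fin: "finite (derived u)" if "u \<in> carrier W" for u
    using vanish[OF that] derived_finite by blast
  have "finite B" unfolding B_def using fin derived_closed v by blast
  have orbit: "f (act ?L (D (- l)) (act ?L (D l) (?t v))) \<in> pms.span B" for l
  proof -
    let ?H = "\<lambda>u. f (act ?L (D (- l)) (laurent_term W u l))"
    have eq: "act ?L (D l) (?t v) = laurent_term W (loop_coeff W lam a b l 0 v) l"
      using act_laurent_term[OF v, of lam a b l 0] by simp
    have mem: "?H (loop_coeff W lam a b l 0 v) \<in> pms.span (?H ` derived v)"
    proof (rule loop_coeff_in_span[OF pms.vector_space_axioms _ _ v])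
      show "?H (u \<oplus>\<^bsub>W\<^esub> w) = ?H u + ?H w" if "u \<in> carrier W" "w \<in> carrier W" for u w
        using that by (simp add: laurent_term_add[of _ _ _ lam a b] t L_add L_closed f_add)
      show "?H (c \<odot>\<^bsub>W\<^esub> u) = Poly_Mapping.map (s c) (?H u)" if "u \<in> carrier W" for c u
        using that by (simp add: laurent_term_smult[of _ _ _ lam a b] t L_smult L_closed f_smult)
    qed
    have sub: "?H ` derived v \<subseteq> pms.span B"
    proof clarify
      fix u assume u: "u \<in> derived v"
      with derived_closed[OF v] have uW: "u \<in> carrier W" by blast
      have "f (?t (loop_coeff W lam a b (- l) l u)) \<in> pms.span ((\<lambda>w. f (?t w)) ` derived u)"
      proof (rule loop_coeff_in_span[OF pms.vector_space_axioms _ _ uW])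
        show "f (?t (u \<oplus>\<^bsub>W\<^esub> w)) = f (?t u) + f (?t w)" if "u \<in> carrier W" "w \<in> carrier W" for u w
          using that by (simp add: laurent_term_add[of _ _ _ lam a b] t f_add)
        show "f (?t (c \<odot>\<^bsub>W\<^esub> u)) = Poly_Mapping.map (s c) (f (?t u))" if "u \<in> carrier W" for c u
          using that by (simp add: laurent_term_smult[of _ _ _ lam a b] t f_smult)
      qed
      also have "\<dots> \<subseteq> pms.span B" by (rule pms.span_mono) (use u in \<open>auto simp: B_def\<close>)
      finally show "?H u \<in> pms.span B" using act_laurent_term[OF uW, of lam a b "- l" l] by simp
    qed
    show ?thesis unfolding eq by (rule subsetD[OF pms.span_minimal[OF sub pms.subspace_span] mem])
  qed
  have weight: "act ?L (D 0) (?t w) = a \<odot>\<^bsub>?L\<^esub> ?t w" if w: "w \<in> carrier W" for w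
  proof -
    obtain n where "\<And>i. i \<ge> int n \<Longrightarrow> act W i w = \<zero>\<^bsub>W\<^esub>" using vanish[OF w] by blast
    from loop_coeff_0[OF w this, where lam = lam and a = a and b = b and j = 0] show ?thesis
      using w by (simp add: act_laurent_term flip: laurent_term_smult)
  qed
  have "\<exists>c. w = c \<odot>\<^bsub>W\<^esub> v" if w: "w \<in> carrier W" for w
  proof -
    have "\<exists>c. ?t w = c \<odot>\<^bsub>?L\<^esub> ?t v"
      by (rule finite_orbit_weight_space[OF _ _ _ \<open>finite B\<close> orbit])
        (use t v w L_closed weight \<open>f (?t v) \<noteq> 0\<close> in \<open>auto simp flip: laurent_term_smult\<close>)
    then show ?thesis using v by (auto simp flip: laurent_term_smult dest: laurent_term_inj)
  qed
  from one_dimensional_trivial[OF v this g] gv show False by simp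
qed

locale highest_weight_vector = witt_representation W for W :: "(int, 'u) rep" +
  fixes w :: 'u and b :: complex
  assumes w: "w \<in> carrier W" and w_nonzero: "w \<noteq> \<zero>\<^bsub>W\<^esub>"
    and weight: "act W 0 w = b \<odot>\<^bsub>W\<^esub> w" and highest: "i > 0 \<Longrightarrow> act W i w = \<zero>\<^bsub>W\<^esub>"
begin

abbreviation "w1 \<equiv> act W (-1) w"
abbreviation "w2 \<equiv> act W (-1) w1"

text \<open>All computations in the highest weight module stay in the span of the highest weight
  vector and its first two derivatives.\<close>

definition comb :: "complex \<Rightarrow> complex \<Rightarrow> complex \<Rightarrow> 'u" where
  "comb x y z = (x \<odot>\<^bsub>W\<^esub> w2 \<oplus>\<^bsub>W\<^esub> y \<odot>\<^bsub>W\<^esub> w1) \<oplus>\<^bsub>W\<^esub> z \<odot>\<^bsub>W\<^esub> w"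

lemma w1: "w1 \<in> carrier W" and w2: "w2 \<in> carrier W"
  by (simp_all add: act_closed w)

lemma comb_closed [simp]: "comb x y z \<in> carrier W"
  by (simp add: comb_def w w1 w2)

lemma comb_add: "comb x y z \<oplus>\<^bsub>W\<^esub> comb x' y' z' = comb (x + x') (y + y') (z + z')"
  by (simp add: comb_def w w1 w2 smult_sum a_ac)

lemma comb_smult: "c \<odot>\<^bsub>W\<^esub> comb x y z = comb (c * x) (c * y) (c * z)"
  by (simp add: comb_def w w1 w2 smult_add smult_smult)

lemma comb_minus: "comb x y z \<ominus>\<^bsub>W\<^esub> comb x' y' z' = comb (x - x') (y - y') (z - z')"
  by (simp add: minus_eq minus_eq_smult comb_smult comb_add)

lemma comb_zero: "comb 0 0 0 = \<zero>\<^bsub>W\<^esub>" and comb_w: "comb 0 0 1 = w"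
  by (simp_all add: comb_def w w1 w2)

lemma act_comb: "i \<ge> -1 \<Longrightarrow> act W i (comb x y z)
    = (x \<odot>\<^bsub>W\<^esub> act W i w2 \<oplus>\<^bsub>W\<^esub> y \<odot>\<^bsub>W\<^esub> act W i w1) \<oplus>\<^bsub>W\<^esub> z \<odot>\<^bsub>W\<^esub> act W i w"
  by (simp add: comb_def w w1 w2 act_add act_smult act_closed)

lemma act_w1: "i \<ge> 0 \<Longrightarrow> act W i w1 =
    act W (-1) (act W i w) \<oplus>\<^bsub>W\<^esub> of_int (- 1 - i) \<odot>\<^bsub>W\<^esub> act W (i - 1) w"
  and act_w2: "i \<ge> 0 \<Longrightarrow> act W i w2 =
    act W (-1) (act W i w1) \<oplus>\<^bsub>W\<^esub> of_int (- 1 - i) \<odot>\<^bsub>W\<^esub> act W (i - 1) w1"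
  using act_commute[of i "-1" w] act_commute[of i "-1" w1] w w1 by simp_all

lemma act_w1_values:
  "act W 0 w1 = comb 0 (b - 1) 0" "act W 1 w1 = comb 0 0 (- 2 * b)" "i \<ge> 2 \<Longrightarrow> act W i w1 = \<zero>\<^bsub>W\<^esub>"
  using act_w1[of 0] act_w1[of 1] act_w1[of i]
  by (simp_all add: weight highest act_smult act_zero comb_def w w1 w2 smult_smult smult_sum act_closed
      flip: smult_sum)

lemma act_w2_values:
  "act W 2 w2 = comb 0 0 (6 * b)" "i \<ge> 3 \<Longrightarrow> act W i w2 = \<zero>\<^bsub>W\<^esub>"
  using act_w2[of 2] act_w2[of i]
  by (simp_all add: act_w1_values act_zero comb_smult)

lemma act_comb_values:
  "act W (-1) (comb 0 y z) = comb y z 0"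
  "act W 0 (comb 0 y z) = comb 0 ((b - 1) * y) (b * z)"
  "act W 1 (comb 0 y z) = comb 0 0 (- 2 * b * y)"
  "i \<ge> 2 \<Longrightarrow> act W i (comb 0 y z) = \<zero>\<^bsub>W\<^esub>"
  "act W 2 (comb x y z) = comb 0 0 (6 * b * x)"
  "i \<ge> 3 \<Longrightarrow> act W i (comb x y z) = \<zero>\<^bsub>W\<^esub>"
proof -
  have w0: "act W 0 w = comb 0 0 b" by (simp add: weight comb_def w1 w2 w)
  show "act W (-1) (comb 0 y z) = comb y z 0"
    unfolding act_comb[OF order.refl]
    by (simp add: w1 w2 w act_closed comb_def a_ac)
  show "act W 0 (comb 0 y z) = comb 0 ((b - 1) * y) (b * z)"
    by (simp add: act_comb act_w1_values w0 comb_smult comb_add w2 act_closed mult.commute)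
  show "act W 1 (comb 0 y z) = comb 0 0 (- 2 * b * y)"
    by (simp add: act_comb act_w1_values highest comb_smult comb_add w2 act_closed mult.commute)
  show "act W i (comb 0 y z) = \<zero>\<^bsub>W\<^esub>" if "i \<ge> 2"
    using that by (simp add: act_comb act_w1_values highest w2 act_closed)
  show "act W 2 (comb x y z) = comb 0 0 (6 * b * x)"
    by (simp add: act_comb act_w1_values act_w2_values highest comb_smult mult.commute)
  show "act W i (comb x y z) = \<zero>\<^bsub>W\<^esub>" if "i \<ge> 3"
    using that by (simp add: act_comb act_w1_values act_w2_values highest)
qed

lemma exp_der_comb:
  "exp_der W k (comb 0 y z) = comb y (z + of_int k * (b - 1) * y) (of_int k * b * z - of_int k ^ 2 * b * y)"
proof -
  have "exp_der W k (comb 0 y z)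
      = finsum W (\<lambda>i::nat. (of_int k ^ i / fact i) \<odot>\<^bsub>W\<^esub> act W (int i - 1) (comb 0 y z)) {..Suc (Suc 0)}"
    by (rule exp_der_atMost) (simp_all add: act_comb_values)
  also have "\<dots> = ((of_int k ^ 2 / 2) \<odot>\<^bsub>W\<^esub> act W 1 (comb 0 y z)) \<oplus>\<^bsub>W\<^esub>
      ((of_int k \<odot>\<^bsub>W\<^esub> act W 0 (comb 0 y z)) \<oplus>\<^bsub>W\<^esub> act W (-1) (comb 0 y z))"
    by (simp add: act_closed Pi_def power2_eq_square)
  also have "\<dots> = comb y (z + of_int k * (b - 1) * y) (of_int k * b * z - of_int k ^ 2 * b * y)"
    by (simp add: act_comb_values comb_smult comb_add algebra_simps)
  finally show ?thesis .
qed

lemma loop_coeff_comb: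
  "loop_coeff W lam a b' k j (comb 0 y z) = comb (lam powi k * y - y)
     (lam powi k * (z + of_int k * (b - 1) * y) - z + (a + of_int k * b' + of_int j) * y)
     (lam powi k * (of_int k * b * z - of_int k ^ 2 * b * y) + (a + of_int k * b' + of_int j) * z)"
  by (simp add: loop_coeff_def exp_der_comb act_comb_values comb_smult comb_minus comb_add)

text \<open>The operator \<open>d\<^sub>2\<close> sends the second derivative to \<open>6 b w\<close> and kills \<open>w\<close>. Its advantage over
  \<open>d\<^sub>1\<close>, applied twice, is that this factor has no zeros other than \<open>b = 0\<close>.\<close>

lemma comb_independent:
  assumes "b \<noteq> 0" "comb x y z = comb 0 0 z'"
  shows "x = 0"
proof (rule ccontr)
  assume "x \<noteq> 0"
  from arg_cong[OF assms(2), of "act W 2"] have "comb 0 0 (6 * b * x) = \<zero>\<^bsub>W\<^esub>"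
    by (simp add: act_comb_values comb_zero)
  then have "(6 * b * x) \<odot>\<^bsub>W\<^esub> comb 0 0 1 = \<zero>\<^bsub>W\<^esub>" by (simp add: comb_smult)
  from smult_eq_zeroD[OF this] assms(1) \<open>x \<noteq> 0\<close> show False by (simp add: comb_w w w_nonzero)
qed

end

text \<open>For even \<open>l\<close> the sign \<open>(- 1) ^ l\<close> is 1, the two occurrences of the derivation in
  \<open>D l (w \<otimes> t ^ j)\<close> cancel, and a multiple of \<open>w \<otimes> t ^ (j + l)\<close> remains; so \<open>D (- l) (D l z)\<close> is a
  multiple of \<open>z = w \<otimes> t ^ e\<close>. Hence the weight spaces are lines. But \<open>z\<close> has the same weight as
  \<open>D 1 (D 1 (w \<otimes> t ^ (e - 2)))\<close>, in which the second derivative of \<open>w\<close> has coefficient 4.\<close>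

theorem loop_part_not_in_tensor:
  assumes hw: "highest_weight_generated W w b" and b: "b \<noteq> 0"
    and tc: "tensor_coordinates s (loop_part e W w a b) f A U a1 b1"
  shows False
proof -
  let ?L = "loop_part e W w a b" and ?M = "loop_module W (-1) a (b + 1)"
  let ?gens = "{(act ?M (D 1) ^^ i) (laurent_term W w (2 * j + e)) | (i::nat) (j::int). True}"
  interpret highest_weight_vector W w b
    using hw by unfold_locales (auto simp: highest_weight_generated_def)
  interpret tensor_coordinates s ?L f A U a1 b1 by (rule tc)
  interpret pms: vector_space "\<lambda>c. Poly_Mapping.map (s c) :: (int \<Rightarrow>\<^sub>0 _) \<Rightarrow> _"
    by (rule vector_space_coefficientwise)
  have L_simps: "carrier ?L = linear_span ?M ?gens" "act ?L = act ?M"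
    "c \<odot>\<^bsub>?L\<^esub> x = c \<odot>\<^bsub>?M\<^esub> x" for c x
    by (simp_all add: loop_part_def Let_def)
  have smult: "x \<in> carrier ?L \<Longrightarrow> c \<odot>\<^bsub>?L\<^esub> x \<in> carrier ?L" for c x
    unfolding L_simps by (rule linear_span_closed)
  have gens: "(act ?M (D 1) ^^ i) (laurent_term W w (2 * j + e)) \<in> carrier ?L" for i j
    unfolding L_simps by (rule subsetD[OF linear_span_inc]) blast
  have scaled: "laurent_term W (comb 0 0 c) (2 * j + e) = c \<odot>\<^bsub>?L\<^esub> laurent_term W w (2 * j + e)" for c j
    unfolding L_simps using laurent_term_smult[OF w, of c] by (simp add: comb_def w w1 w2)
  let ?z = "laurent_term W w e"
  have z: "?z \<in> carrier ?L" using gens[of 0 0] by simp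
  have fz: "f ?z \<noteq> 0"
  proof (rule nonzero_image[OF z smult[OF z]])
    show "0 \<odot>\<^bsub>?L\<^esub> ?z \<noteq> ?z"
      using laurent_term_inj[of "comb 0 0 0" e w] scaled[of 0 0] w_nonzero comb_zero by auto
  qed
  have even: "\<exists>d. act ?L (D l) (laurent_term W (comb 0 0 c) j) = laurent_term W (comb 0 0 d) (j + l)"
    if "even l" for l c j
  proof -
    have "(- 1 :: complex) powi l = 1"
      using that by (auto elim!: evenE simp: power_int_mult)
    then show ?thesis by (simp add: L_simps act_laurent_term loop_coeff_comb) blast
  qed
  have step: "act ?L (D l) ?z \<in> carrier ?L \<and> f (act ?L (D (- l)) (act ?L (D l) ?z)) \<in> pms.span {f ?z}"
    if l: "even l" for l
  proof -
    from even[OF l, of 1 e] obtain c where c: "act ?L (D l) ?z = laurent_term W (comb 0 0 c) (e + l)"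
      by (auto simp: comb_w)
    from even[of "- l" c "e + l"] l obtain d where
      d: "act ?L (D (- l)) (act ?L (D l) ?z) = laurent_term W (comb 0 0 d) e"
      by (auto simp: c)
    obtain l' where l': "l = 2 * l'" using l by blast
    have "act ?L (D l) ?z = c \<odot>\<^bsub>?L\<^esub> laurent_term W w (2 * l' + e)"
      unfolding c using scaled[of c l'] by (simp add: l' add.commute)
    moreover have "act ?L (D (- l)) (act ?L (D l) ?z) = d \<odot>\<^bsub>?L\<^esub> ?z"
      unfolding d using scaled[of d 0] by simp
    ultimately show ?thesis
      using smult gens[of 0 l'] z by (auto simp: f_smult intro: pms.span_scale pms.span_base)
  qed
  \<comment> \<open>the generator with exponent 2 and index \<open>- 1\<close>, which has the weight of \<open>?z\<close>\<close>
  let ?y = "(act ?M (D 1) ^^ 2) (laurent_term W w (2 * (- 1) + e))"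
  obtain y z where y: "?y = laurent_term W (comb 4 y z) e"
  proof -
    have "laurent_term W w (2 * (- 1) + e) = laurent_term W (comb 0 0 1) (e - 2)" by (simp add: comb_w)
    then show ?thesis
      using that by (simp add: numeral_2_eq_2 act_laurent_term loop_coeff_comb)
  qed
  have weight: "act ?L (D 0) (laurent_term W (comb x y z) e) = (a + of_int e) \<odot>\<^bsub>?L\<^esub> laurent_term W (comb x y z) e"
    for x y z
    using loop_coeff_0[of "comb x y z" 3] act_comb_values(6)
    by (simp add: L_simps act_laurent_term flip: laurent_term_smult)
  have "\<exists>c. ?y = c \<odot>\<^bsub>?L\<^esub> ?z"
  proof (rule finite_orbit_weight_space[OF z fz _ _ _ z fz])
    show "act ?L (D 0) ?z = (a + of_int e) \<odot>\<^bsub>?L\<^esub> ?z" using weight[of 0 0 1] by (simp add: comb_w)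
    show "act ?L (D 0) ?y = (a + of_int e) \<odot>\<^bsub>?L\<^esub> ?y" unfolding y by (rule weight)
    show "?y \<in> carrier ?L" by (rule gens)
    show "finite {f ?z}" by simp
  qed (use step smult z in auto)
  then obtain c where "laurent_term W (comb 4 y z) e = laurent_term W (comb 0 0 c) e"
    using y scaled[of _ 0] by auto
  then have "comb 4 y z = comb 0 0 c" by (rule laurent_term_inj)
  from comb_independent[OF b this] show False by simp
qed

section \<open>Loop modules are not submodules of the tensor product\<close>

theorem theorem16:
  fixes W :: "(int, 'w) rep" and W' :: "(int, 'u) rep" and w\<^sub>0 :: 'u
    and lam a b c h a\<^sub>1 b\<^sub>1 :: complex
  assumes "lam \<noteq> 0"
    and "category_O W" and "simple_module witt W" and "nontrivial_module witt W"
    and "maximal_submodule virasoro (verma c h) J"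
    and "V = quotient_module (verma c h) J"
  shows "(simple_module virasoro (loop_module W lam a b) \<longrightarrow>
            \<not> isomorphic_to_simple_submodule virasoro (loop_module W lam a b)
                (tensor_module V (intermediate_simple a\<^sub>1 b\<^sub>1))) \<and>
         (b \<noteq> 0 \<and> highest_weight_generated W' w\<^sub>0 b \<longrightarrow>
            \<not> isomorphic_to_simple_submodule virasoro (loop_module_0 W' w\<^sub>0 a b)
                (tensor_module V (intermediate_simple a\<^sub>1 b\<^sub>1)) \<and>
            \<not> isomorphic_to_simple_submodule virasoro (loop_module_1 W' w\<^sub>0 a b)
                (tensor_module V (intermediate_simple a\<^sub>1 b\<^sub>1)))"
proof -
  note coordinates = coordinates_of_submodule[OF assms(5,6)]
  have "\<not> isomorphic_to_simple_submodule virasoro (loop_module W lam a b)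
      (tensor_module V (intermediate_simple a\<^sub>1 b\<^sub>1))"
    if "simple_module virasoro (loop_module W lam a b)"
    using coordinates loop_module_not_in_tensor[OF assms(2,4) that] by metis
  moreover have "\<not> isomorphic_to_simple_submodule virasoro (loop_part e W' w\<^sub>0 a b)
      (tensor_module V (intermediate_simple a\<^sub>1 b\<^sub>1))"
    if "b \<noteq> 0" "highest_weight_generated W' w\<^sub>0 b" for e
    using coordinates loop_part_not_in_tensor[OF that(2,1)] by metis
  ultimately show ?thesis
    unfolding loop_module_0_def loop_module_1_def by blast
qed

end
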